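(* A nonconfluent parallel ensemble IMEX Euler method, i.e. an IMEX general linear method with $s$ internal and $r=s$ external stages, distinct abscissae $c_1,\dots,c_s$, and the structural assumptions $$\mathbf{A}=\mathbf{0}_{s\times s},\qquad \widehat{\mathbf{A}}=\lambda\,\mathbf{I}_{s\times s},\qquad \mathbf{U}=\mathbf{V}=\mathbf{I}_{s\times s}$$ (with $\lambda>0$), has $p=q=r=s$ (order $p=s$ and stage order $q=s$) if and only if the remaining method coefficients are $$\mathbf{W}=\mathbf{C}_{s+1},\qquad \widehat{\mathbf{W}}=\mathbf{C}_{s+1}-\lambda\,\mathbf{C}_{s+1}\,\mathbf{K}_{s+1},$$ $$\mathbf{B}=\mathbf{C}_s\,\mathbf{F}_s\,\mathbf{C}_s^{-1},\qquad \widehat{\mathbf{B}}=\mathbf{C}_s\,\mathbf{F}_s\left(\mathbf{I}_{s\times s}-\lambda\,\mathbf{K}_s\right)\mathbf{C}_s^{-1},$$ where $\mathbf{F}_n\in\mathbb{R}^{n\times n}$ is the upper triangular Toeplitz matrix with entries $(\mathbf{F}_n)_{i,j}=\frac{1}{(j-i+1)!}$ for $j\ge i$ and $0$ for $j<i$.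
   Context: Setting: the autonomous ODE $y'=f(y)+g(y)$, $y(t)\in\mathbb{R}^d$, with $f,g$ sufficiently smooth. An IMEX general linear method (IMEX GLM) with $s$ internal stages $Y_i$, $r$ external stages $y^{[n]}_i$, timestep $h$, abscissae $\mathbf{c}=(c_1,\dots,c_s)^T\in\mathbb{R}^s$ and coefficient matrices $\mathbf{A}=(a_{i,j})$ (strictly lower triangular) and $\widehat{\mathbf{A}}=(\widehat a_{i,j})$ (lower triangular) in $\mathbb{R}^{s\times s}$, $\mathbf{B}=(b_{i,j}),\widehat{\mathbf{B}}=(\widehat b_{i,j})\in\mathbb{R}^{r\times s}$, $\mathbf{U}=(u_{i,j})\in\mathbb{R}^{s\times r}$, $\mathbf{V}=(v_{i,j})\in\mathbb{R}^{r\times r}$ is $$Y_i=h\sum_{j=1}^{i-1}a_{i,j}f(Y_j)+h\sum_{j=1}^{i}\widehat a_{i,j}g(Y_j)+\sum_{j=1}^r u_{i,j}y^{[n-1]}_j,\quad i=1,\dots,s,$$ $$y^{[n]}_i=h\sum_{j=1}^s\left(b_{i,j}f(Y_j)+\widehat b_{i,j}g(Y_j)\right)+\sum_{j=1}^r v_{i,j}y^{[n-1]}_j,\quad i=1,\dots,r.$$ Nonconfluent means that the $c_i$ are distinct. Order. The external stage weights are matrices $\mathbf{W}=(w_{i,k}),\widehat{\mathbf{W}}=(\widehat w_{i,k})\in\mathbb{R}^{r\times(p+1)}$, $k=0,\dots,p$, with $w_{i,0}=\widehat w_{i,0}$; they count among the method's coefficients. Assume the incoming external stages satisfy $$y^{[n-1]}_i=w_{i,0}\,y(t_{n-1})+\sum_{k=1}^p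 w_{i,k}h^k\frac{d^{k-1}f(y(t))}{dt^{k-1}}(t_{n-1})+\sum_{k=1}^p\widehat w_{i,k}h^k\frac{d^{k-1}g(y(t))}{dt^{k-1}}(t_{n-1})+O(h^{p+1}).$$ The method has stage order $q$ if $Y_i=y(t_{n-1}+c_ih)+O(h^{q+1})$ for all $i$, and order $p$ if $y^{[n]}_i$ satisfies the same expansion with $t_{n-1}$ replaced by $t_n=t_{n-1}+h$. Notation. $\mathbf{K}_n\in\mathbb{R}^{n\times n}$ has ones on the first superdiagonal and zeros elsewhere; $\mathbf{E}_n=\exp(\mathbf{K}_n)$; $\mathbf{C}_n=\left[\mathbf{1}_s\ \ \mathbf{c}\ \ \tfrac{\mathbf{c}^2}{2}\ \cdots\ \tfrac{\mathbf{c}^{n-1}}{(n-1)!}\right]\in\mathbb{R}^{s\times n}$, with component-wise powers and $\mathbf{1}_s$ the vector of ones. Known characterization (Zhang, Sandu, Blaise), which may be used: the IMEX GLM has order $p$ and stage order $q\in\{p,p-1\}$ iff $$\mathbf{C}_{q+1}-\mathbf{A}\mathbf{C}_{q+1}\mathbf{K}_{q+1}-\mathbf{U}\mathbf{W}_{:,0:q}=\mathbf{0},\qquad \mathbf{C}_{q+1}-\widehat{\mathbf{A}}\mathbf{C}_{q+1}\mathbf{K}_{q+1}-\mathbf{U}\widehat{\mathbf{W}}_{:,0:q}=\mathbf{0},$$ $$\mathbf{W}\mathbf{E}_{p+1}-\mathbf{B}\mathbf{C}_{p+1}\mathbf{K}_{p+1}-\mathbf{V}\mathbf{W}=\mathbf{0},\qquad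 \widehat{\mathbf{W}}\mathbf{E}_{p+1}-\widehat{\mathbf{B}}\mathbf{C}_{p+1}\mathbf{K}_{p+1}-\mathbf{V}\widehat{\mathbf{W}}=\mathbf{0},$$ where $\mathbf{W}_{:,0:q}$ denotes the first $q+1$ columns. *)

theory Defs
  imports
    "HOL-Analysis.Derivative"
    "HOL-Library.Landau_Symbols"
    "Jordan_Normal_Form.Gauss_Jordan_Elimination"
begin

(* All stage and coefficient indices are 0-based: Y_1,...,Y_s is Y 0,...,Y (s-1). The external
   stage weights w_{i,k}, k = 0,...,p, keep their column index k. *)

record imex_glm =
  glm_c :: "real vec"
  glm_A :: "real mat"
  glm_Ahat :: "real mat"
  glm_B :: "real mat"
  glm_Bhat :: "real mat"
  glm_U :: "real mat"
  glm_V :: "real mat"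
  glm_W :: "real mat"
  glm_What :: "real mat"

definition is_imex_glm :: "nat \<Rightarrow> nat \<Rightarrow> nat \<Rightarrow> imex_glm \<Rightarrow> bool" where
  "is_imex_glm s r p M \<longleftrightarrow>
     glm_c M \<in> carrier_vec s \<and>
     glm_A M \<in> carrier_mat s s \<and> glm_Ahat M \<in> carrier_mat s s \<and>
     glm_B M \<in> carrier_mat r s \<and> glm_Bhat M \<in> carrier_mat r s \<and>
     glm_U M \<in> carrier_mat s r \<and> glm_V M \<in> carrier_mat r r \<and>
     glm_W M \<in> carrier_mat r (p + 1) \<and> glm_What M \<in> carrier_mat r (p + 1) \<and>
     (\<forall>i<s. \<forall>j<s. i \<le> j \<longrightarrow> glm_A M $$ (i, j) = 0) \<and>
     (\<forall>i<s. \<forall>j<s. i < j \<longrightarrow> glm_Ahat M $$ (i, j) = 0) \<and>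
     (\<forall>i<r. glm_W M $$ (i, 0) = glm_What M $$ (i, 0))"

definition nonconfluent :: "imex_glm \<Rightarrow> bool" where
  "nonconfluent M \<longleftrightarrow> inj_on (\<lambda>i. glm_c M $ i) {..<dim_vec (glm_c M)}"

definition imex_glm_step ::
  "nat \<Rightarrow> nat \<Rightarrow> imex_glm \<Rightarrow> ('a::euclidean_space \<Rightarrow> 'a) \<Rightarrow> ('a \<Rightarrow> 'a) \<Rightarrow> real \<Rightarrow>
   (nat \<Rightarrow> 'a) \<Rightarrow> (nat \<Rightarrow> 'a) \<Rightarrow> (nat \<Rightarrow> 'a) \<Rightarrow> bool" where
  "imex_glm_step s r M f g h yin Y yout \<longleftrightarrow>
     (\<forall>i<s. Y i = h *\<^sub>R (\<Sum>j<i. glm_A M $$ (i, j) *\<^sub>R f (Y j))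
               + h *\<^sub>R (\<Sum>j\<le>i. glm_Ahat M $$ (i, j) *\<^sub>R g (Y j))
               + (\<Sum>j<r. glm_U M $$ (i, j) *\<^sub>R yin j)) \<and>
     (\<forall>i<r. yout i = h *\<^sub>R (\<Sum>j<s. glm_B M $$ (i, j) *\<^sub>R f (Y j) + glm_Bhat M $$ (i, j) *\<^sub>R g (Y j))
               + (\<Sum>j<r. glm_V M $$ (i, j) *\<^sub>R yin j))"

(* Functions of class C^n: in finite dimension this is equivalent to continuity of all iterated
   directional derivatives up to order n. *)
fun C_class :: "nat \<Rightarrow> ('a::euclidean_space \<Rightarrow> 'b::euclidean_space) \<Rightarrow> bool" where
  "C_class 0 f \<longleftrightarrow> continuous_on UNIV f"
| "C_class (Suc n) f \<longleftrightarrow>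
     (\<forall>x. f differentiable (at x)) \<and> (\<forall>v. C_class n (\<lambda>x. frechet_derivative f (at x) v))"

definition time_deriv :: "nat \<Rightarrow> (real \<Rightarrow> 'a::real_normed_vector) \<Rightarrow> real \<Rightarrow> 'a" where
  "time_deriv k \<phi> = ((\<lambda>\<psi> t. vector_derivative \<psi> (at t)) ^^ k) \<phi>"

definition solves_ode_near ::
  "('a::euclidean_space \<Rightarrow> 'a) \<Rightarrow> ('a \<Rightarrow> 'a) \<Rightarrow> (real \<Rightarrow> 'a) \<Rightarrow> real \<Rightarrow> bool" where
  "solves_ode_near f g y t0 \<longleftrightarrow>
     (\<exists>a b. a < t0 \<and> t0 < b \<and>
        (\<forall>t\<in>{a<..<b}. (y has_vector_derivative f (y t) + g (y t)) (at t)))"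

definition ext_expansion ::
  "nat \<Rightarrow> imex_glm \<Rightarrow> ('a::euclidean_space \<Rightarrow> 'a) \<Rightarrow> ('a \<Rightarrow> 'a) \<Rightarrow> (real \<Rightarrow> 'a) \<Rightarrow>
   real \<Rightarrow> real \<Rightarrow> nat \<Rightarrow> 'a" where
  "ext_expansion p M f g y t h i =
     glm_W M $$ (i, 0) *\<^sub>R y t
     + (\<Sum>k=1..p. (glm_W M $$ (i, k) * h ^ k) *\<^sub>R time_deriv (k - 1) (\<lambda>\<tau>. f (y \<tau>)) t)
     + (\<Sum>k=1..p. (glm_What M $$ (i, k) * h ^ k) *\<^sub>R time_deriv (k - 1) (\<lambda>\<tau>. g (y \<tau>)) t)"

(* One step from t0 (the time t_{n-1}), for a family of timesteps h tending to 0 from the right.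
   The implicit stage equations can have spurious solutions that blow up as h tends to 0 (for
   instance when g is quadratic), so the stages are required to stay bounded. This picks the
   solution branch given by the implicit function theorem and is no restriction on the
   coefficients. *)
definition local_step ::
  "nat \<Rightarrow> nat \<Rightarrow> nat \<Rightarrow> imex_glm \<Rightarrow> ('a::euclidean_space \<Rightarrow> 'a) \<Rightarrow> ('a \<Rightarrow> 'a) \<Rightarrow> (real \<Rightarrow> 'a) \<Rightarrow> real \<Rightarrow>
   (real \<Rightarrow> nat \<Rightarrow> 'a) \<Rightarrow> (real \<Rightarrow> nat \<Rightarrow> 'a) \<Rightarrow> (real \<Rightarrow> nat \<Rightarrow> 'a) \<Rightarrow> bool" where
  "local_step s r p M f g y t0 yin Y yout \<longleftrightarrow>
     solves_ode_near f g y t0 \<and>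
     (\<forall>i<r. (\<lambda>h. norm (yin h i - ext_expansion p M f g y t0 h i)) \<in> O[at_right 0](\<lambda>h. h ^ (p + 1))) \<and>
     (\<forall>\<^sub>F h in at_right 0. imex_glm_step s r M f g h (yin h) (Y h) (yout h)) \<and>
     (\<forall>i<s. (\<lambda>h. norm (Y h i)) \<in> O[at_right 0](\<lambda>h. 1))"

(* The ODE lives in the Euclidean space 'a. "Sufficiently smooth" f and g means of class C^N for
   some N depending only on the method. *)
definition has_stage_order ::
  "'a::euclidean_space itself \<Rightarrow> nat \<Rightarrow> nat \<Rightarrow> nat \<Rightarrow> imex_glm \<Rightarrow> nat \<Rightarrow> bool" where
  "has_stage_order _ s r p M q \<longleftrightarrow>
     (\<exists>N. \<forall>(f::'a \<Rightarrow> 'a) g y t0 yin Y yout.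
        C_class N f \<longrightarrow> C_class N g \<longrightarrow> local_step s r p M f g y t0 yin Y yout \<longrightarrow>
        (\<forall>i<s. (\<lambda>h. norm (Y h i - y (t0 + glm_c M $ i * h))) \<in> O[at_right 0](\<lambda>h. h ^ (q + 1))))"

definition has_order ::
  "'a::euclidean_space itself \<Rightarrow> nat \<Rightarrow> nat \<Rightarrow> imex_glm \<Rightarrow> nat \<Rightarrow> bool" where
  "has_order _ s r M p \<longleftrightarrow>
     (\<exists>N. \<forall>(f::'a \<Rightarrow> 'a) g y t0 yin Y yout.
        C_class N f \<longrightarrow> C_class N g \<longrightarrow> local_step s r p M f g y t0 yin Y yout \<longrightarrow>
        (\<forall>i<r. (\<lambda>h. norm (yout h i - ext_expansion p M f g y (t0 + h) h i))
                 \<in> O[at_right 0](\<lambda>h. h ^ (p + 1))))"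

definition K_mat :: "nat \<Rightarrow> real mat" where
  "K_mat n = mat n n (\<lambda>(i, j). if j = i + 1 then 1 else 0)"

definition C_mat :: "real vec \<Rightarrow> nat \<Rightarrow> real mat" where
  "C_mat c n = mat (dim_vec c) n (\<lambda>(i, j). (c $ i) ^ j / fact j)"

definition F_mat :: "nat \<Rightarrow> real mat" where
  "F_mat n = mat n n (\<lambda>(i, j). if i \<le> j then 1 / fact (j - i + 1) else 0)"

(* The value is unspecified for singular matrices; C_mat c s is invertible for distinct abscissae. *)
definition inv_mat :: "real mat \<Rightarrow> real mat" where
  "inv_mat A = the (mat_inverse A)"

end

theory Submission
  imports Defs "Jordan_Normal_Form.Determinant"
begin

text \<open>With \<open>A = 0\<close>, \<open>Ahat = lam I\<close>, \<open>U = V = I\<close>, stage \<open>i\<close> reads \<open>Y\<^sub>i - h lam g (Y\<^sub>i) = y\<^sub>i\<close> with \<open>y\<^sub>i\<close> the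
  incoming external stage. Stage order \<open>s\<close> therefore means that \<open>y\<^sub>i\<close> is
  \<open>y (t + c\<^sub>i h) - h lam g (y (t + c\<^sub>i h))\<close> up to \<open>O(h\<^bsup>s+1\<^esup>)\<close>; Taylor expansion turns this into the formulas
  for \<open>W\<close> and \<open>What\<close>. Expanding the output stage gives \<open>B C\<^sub>s = C\<^sub>s F\<^sub>s\<close> and its implicit
  analogue, and \<open>C\<^sub>s\<close> is an invertible scaled Vandermonde matrix. Linear test equations already force
  all the conditions; conversely the conditions suffice for smooth nonlinear problems because \<open>g\<close> is
  Lipschitz near the bounded stages.\<close>

section \<open>Remainders of order \<open>h\<^bsup>n\<^esup>\<close> and Taylor expansion\<close>

text \<open>The explicit and the implicit coefficients decouple into the same pair of conditions,
  with parameter 0 for the former and \<open>lam\<close> for the latter. As \<open>V\<close> is the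
  identity, the output condition is W (E - I) = B C K; dropping its empty column 0 leaves B C = X F,
  where X holds the first s columns of the weights. For the implicit part X = C - \<open>lam\<close>
  C K, and since K and F commute, X F becomes C F (I - \<open>lam\<close> K).

  Two losses of accuracy have to be balanced. The stage error occurs on both sides of the implicit
  stage equation, but on the right with a factor h, so for small h it can be absorbed. Function
  values along the solution are expanded one order less far than the solution itself, which suffices
  because they too enter with a factor h.

  For necessity, the smoothness class C^N in the definitions of order has an unknown N, so the test
  problem has to lie in every class.\<close>

definition remainder :: "nat \<Rightarrow> (real \<Rightarrow> 'a::real_normed_vector) \<Rightarrow> bool" where
  "remainder n u \<longleftrightarrow> (\<exists>C. \<forall>\<^sub>F h in at_right 0. norm (u h) \<le> C * h ^ n)"

text \<open>Bridge to the Landau form in the order definitions: \<open>h\<close> is eventually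
  positive, so \<open>h ^ n\<close> is its own absolute value.\<close>

lemma remainder_iff_bigo:
  "remainder n u \<longleftrightarrow> (\<lambda>h. norm (u h)) \<in> O[at_right 0](\<lambda>h. h ^ n)"
proof -
  have pos: "\<forall>\<^sub>F h in at_right (0::real). 0 < h"
    by (rule eventually_at_right_less)
  show ?thesis
  proof
    assume "remainder n u"
    then obtain C where C: "\<forall>\<^sub>F h in at_right 0. norm (u h) \<le> C * h ^ n"
      unfolding remainder_def by blast
    show "(\<lambda>h. norm (u h)) \<in> O[at_right 0](\<lambda>h. h ^ n)"
      by (rule bigoI[of _ C], use C pos in eventually_elim) auto
  next
    assume "(\<lambda>h. norm (u h)) \<in> O[at_right 0](\<lambda>h. h ^ n)"
    then obtain C where C: "\<forall>\<^sub>F h in at_right 0. norm (norm (u h)) \<le> C * norm (h ^ n)"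
      by (elim landau_o.bigE) auto
    show "remainder n u"
      unfolding remainder_def
      by (rule exI[of _ C], use C pos in eventually_elim) auto
  qed
qed

lemma remainder_dominated:
  assumes "remainder n u" and "\<forall>\<^sub>F h in at_right 0. norm (v h) \<le> K * norm (u h)" and "K \<ge> 0"
  shows "remainder n v"
proof -
  obtain C where "\<forall>\<^sub>F h in at_right 0. norm (u h) \<le> C * h ^ n"
    using assms(1) unfolding remainder_def by blast
  with assms(2) have "\<forall>\<^sub>F h in at_right 0. norm (v h) \<le> (K * C) * h ^ n"
  proof eventually_elim
    case (elim h)
    show ?case
      using mult_left_mono[OF elim(2) assms(3)] elim(1) by (simp add: mult.assoc)
  qed
  thus ?thesis unfolding remainder_def by blast
qed

lemma remainder_cong:
  assumes "\<forall>\<^sub>F h in at_right 0. u h = v h" and "remainder n u"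
  shows "remainder n v"
  by (rule remainder_dominated[OF assms(2), of _ 1], use assms(1) in eventually_elim) auto

lemma remainder_0 [simp]: "remainder n (\<lambda>_. 0)"
  unfolding remainder_def by (rule exI[of _ 0]) simp

lemma remainder_add:
  assumes "remainder n u" "remainder n v"
  shows "remainder n (\<lambda>h. u h + v h)"
proof -
  obtain C D where "\<forall>\<^sub>F h in at_right 0. norm (u h) \<le> C * h ^ n"
    "\<forall>\<^sub>F h in at_right 0. norm (v h) \<le> D * h ^ n"
    using assms unfolding remainder_def by blast
  hence "\<forall>\<^sub>F h in at_right 0. norm (u h + v h) \<le> (C + D) * h ^ n"
    by eventually_elim (auto simp: algebra_simps intro: order_trans[OF norm_triangle_ineq])
  thus ?thesis unfolding remainder_def by blast
qed

lemma remainder_scaleR: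
  assumes "remainder n u" shows "remainder n (\<lambda>h. c *\<^sub>R u h)"
  by (rule remainder_dominated[OF assms, of _ "\<bar>c\<bar>"]) auto

lemma remainder_minus: "remainder n u \<Longrightarrow> remainder n (\<lambda>h. - u h)"
  using remainder_scaleR[of n u "-1"] by simp

lemma remainder_diff:
  "remainder n u \<Longrightarrow> remainder n v \<Longrightarrow> remainder n (\<lambda>h. u h - v h)"
  using remainder_add[OF _ remainder_minus, of n u v] by simp

lemma remainder_sum:
  "(\<And>i. i \<in> I \<Longrightarrow> remainder n (u i)) \<Longrightarrow> remainder n (\<lambda>h. \<Sum>i\<in>I. u i h)"
  by (induction I rule: infinite_finite_induct) (auto intro: remainder_add)

lemma remainder_power_scaleR:
  assumes "remainder n u" shows "remainder (m + n) (\<lambda>h. h ^ m *\<^sub>R u h)"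
proof -
  obtain C where C: "\<forall>\<^sub>F h in at_right 0. norm (u h) \<le> C * h ^ n"
    using assms unfolding remainder_def by blast
  have "\<forall>\<^sub>F h in at_right (0::real). 0 < h"
    by (rule eventually_at_right_less)
  with C have "\<forall>\<^sub>F h in at_right 0. norm (h ^ m *\<^sub>R u h) \<le> C * h ^ (m + n)"
  proof eventually_elim
    case (elim h)
    show ?case
      using mult_left_mono[OF elim(1), of "h ^ m"] elim(2)
      by (simp add: power_add mult_ac)
  qed
  thus ?thesis unfolding remainder_def by blast
qed

lemma remainder_Suc: "remainder n u \<Longrightarrow> remainder (Suc n) (\<lambda>h. h *\<^sub>R u h)"
  using remainder_power_scaleR[of n u 1] by simp

lemma remainder_mono:
  assumes "remainder n u" "m \<le> n" shows "remainder m u"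
proof -
  obtain C where C: "\<forall>\<^sub>F h in at_right 0. norm (u h) \<le> C * h ^ n"
    using assms unfolding remainder_def by blast
  have "\<forall>\<^sub>F h in at_right (0::real). 0 < h \<and> h < 1"
    using eventually_at_right_real[of 0 1] by auto
  \<comment> \<open>Nothing forces \<open>C\<close> to be non-negative, hence the absolute value;
    the power may be lowered because \<open>h < 1\<close>.\<close>
  with C have "\<forall>\<^sub>F h in at_right 0. norm (u h) \<le> \<bar>C\<bar> * h ^ m"
  proof eventually_elim
    case (elim h)
    have "C * h ^ n \<le> \<bar>C\<bar> * h ^ m"
      using elim(2) assms(2) by (intro mult_mono power_decreasing) auto
    thus ?case using elim(1) by linarith
  qed
  thus ?thesis unfolding remainder_def by blast
qed

lemma remainder_1_tendsto_0:
  assumes "remainder (Suc n) u" shows "(u \<longlongrightarrow> 0) (at_right 0)"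
proof -
  obtain C where C: "\<forall>\<^sub>F h in at_right 0. norm (u h) \<le> C * h ^ Suc n"
    using assms unfolding remainder_def by blast
  have "((\<lambda>h::real. C * h ^ Suc n) \<longlongrightarrow> C * 0 ^ Suc n) (at_right 0)"
    by (intro tendsto_intros)
  thus ?thesis
    using C by (intro Lim_null_comparison[OF C]) simp
qed

text \<open>Letting \<open>h\<close> tend to 0 kills the constant term; dividing by \<open>h\<close>
  leaves the same situation one degree lower. This is what turns asymptotic bounds into equations
  between coefficients.\<close>

lemma remainder_polynomial_imp_0:
  fixes a :: "nat \<Rightarrow> real"
  assumes "remainder n (\<lambda>h. \<Sum>k<n. a k * h ^ k)" and "k < n"
  shows "a k = 0"
  using assms
proof (induction n arbitrary: a k)
  case 0
  then show ?case by simp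
next
  case (Suc n)
  define q where "q h = (\<Sum>k<n. a (Suc k) * h ^ k)" for h
  have split: "(\<Sum>k<Suc n. a k * h ^ k) = a 0 + h * q h" for h
    unfolding q_def sum.lessThan_Suc_shift by (simp add: sum_distrib_left mult_ac)
  have "((\<lambda>h. a 0 + h * q h) \<longlongrightarrow> a 0 + 0 * q 0) (at_right 0)"
    unfolding q_def by (intro tendsto_intros)
  moreover have "((\<lambda>h. a 0 + h * q h) \<longlongrightarrow> 0) (at_right 0)"
    using remainder_1_tendsto_0[OF Suc.prems(1)] unfolding split .
  ultimately have "a 0 + 0 * q 0 = 0"
    by (rule tendsto_unique[OF trivial_limit_at_right_real])
  hence a0: "a 0 = 0" by simp
  have "\<forall>\<^sub>F h in at_right (0::real). 0 < h"
    by (rule eventually_at_right_less)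
  moreover obtain C where "\<forall>\<^sub>F h in at_right 0. norm (h * q h) \<le> C * h ^ Suc n"
    using Suc.prems(1) a0 unfolding split remainder_def by auto
  ultimately have "\<forall>\<^sub>F h in at_right 0. norm (q h) \<le> C * h ^ n"
    by eventually_elim (simp add: abs_mult)
  hence "remainder n (\<lambda>h. \<Sum>k<n. a (Suc k) * h ^ k)"
    unfolding remainder_def q_def by blast
  from Suc.IH[OF this] a0 Suc.prems(2) show ?case
    by (cases k) auto
qed

text \<open>Vector values rule out the Lagrange form, so the bound for the shifted chain is carried
  back by the mean value inequality, gaining one power of \<open>x\<close> at each level. Continuity
  of the last function \<open>D n\<close> starts the induction, as it is locally bounded. The
  estimate is two-sided in \<open>x\<close> because abscissae may be negative.\<close>

lemma taylor_local_bound: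
  fixes D :: "nat \<Rightarrow> real \<Rightarrow> 'a::real_normed_vector"
  assumes "open S" "t0 \<in> S"
    and "\<And>k t. k < n \<Longrightarrow> t \<in> S \<Longrightarrow> (D k has_vector_derivative D (Suc k) t) (at t)"
    and "continuous_on S (D n)"
  shows "\<exists>C d. d > 0 \<and> (\<forall>x. \<bar>x\<bar> < d \<longrightarrow>
           norm (D 0 (t0 + x) - (\<Sum>k<n. (x ^ k / fact k) *\<^sub>R D k t0)) \<le> C * \<bar>x\<bar> ^ n)"
  using assms(3,4)
proof (induction n arbitrary: D)
  case 0
  have "isCont (D 0) t0"
    using 0 assms(1,2) continuous_on_eq_continuous_at by blast
  hence "(D 0 \<longlongrightarrow> D 0 t0) (nhds t0)"
    by (simp add: isCont_def tendsto_at_iff_tendsto_nhds)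
  hence "\<forall>\<^sub>F t in nhds t0. dist (D 0 t) (D 0 t0) < 1"
    by (rule tendstoD) simp
  then obtain d where "d > 0" and d: "\<And>t. dist t t0 < d \<Longrightarrow> dist (D 0 t) (D 0 t0) < 1"
    unfolding eventually_nhds_metric by blast
  hence "norm (D 0 (t0 + x)) \<le> norm (D 0 t0) + 1" if "\<bar>x\<bar> < d" for x
  proof -
    have "norm (D 0 (t0 + x) - D 0 t0) < 1"
      using that d[of "t0 + x"]
      by (simp add: dist_norm)
    thus ?thesis using norm_triangle_ineq2[of "D 0 (t0 + x)" "D 0 t0"] by linarith
  qed
  thus ?case using \<open>d > 0\<close> by (intro exI[of _ "norm (D 0 t0) + 1"] exI[of _ d]) auto
next
  case (Suc n)
  have "\<exists>C d. d > 0 \<and> (\<forall>x. \<bar>x\<bar> < d \<longrightarrow>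
           norm (D (Suc 0) (t0 + x) - (\<Sum>k<n. (x ^ k / fact k) *\<^sub>R D (Suc k) t0)) \<le> C * \<bar>x\<bar> ^ n)"
    using Suc.IH[of "\<lambda>k. D (Suc k)"] Suc.prems by auto
  then obtain C d where d: "d > 0" and C: "\<And>x. \<bar>x\<bar> < d \<Longrightarrow>
      norm (D (Suc 0) (t0 + x) - (\<Sum>k<n. (x ^ k / fact k) *\<^sub>R D (Suc k) t0)) \<le> C * \<bar>x\<bar> ^ n"
    by blast
  obtain e where e: "e > 0" "ball t0 e \<subseteq> S"
    using assms(1,2) openE by blast
  define R where "R x = D 0 (t0 + x) - (\<Sum>k<Suc n. (x ^ k / fact k) *\<^sub>R D k t0)" for x
  define R' where "R' x = D (Suc 0) (t0 + x) - (\<Sum>k<n. (x ^ k / fact k) *\<^sub>R D (Suc k) t0)" for x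
  have R0: "R 0 = 0"
    unfolding R_def by (simp add: sum.lessThan_Suc_shift del: sum.lessThan_Suc)
  have deriv: "(R has_vector_derivative R' x) (at x)" if "\<bar>x\<bar> < e" for x
  proof -
    have "t0 + x \<in> S" using that e(2) by (auto simp: dist_norm)
    moreover have shift: "((+) t0 has_vector_derivative 1) (at x)"
      by (auto intro!: derivative_eq_intros)
    ultimately have 1: "((\<lambda>x. D 0 (t0 + x)) has_vector_derivative D (Suc 0) (t0 + x)) (at x)"
      using vector_diff_chain_at[of "\<lambda>x. t0 + x" 1 x "D 0" "D (Suc 0) (t0 + x)"]
        Suc.prems(1)[of 0 "t0 + x"] shift
      by (simp add: o_def)
    have 2: "((\<lambda>x. (x ^ Suc k / fact (Suc k)) *\<^sub>R D (Suc k) t0) has_vector_derivative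
        (x ^ k / fact k) *\<^sub>R D (Suc k) t0) (at x)" for k
    proof -
      have "((\<lambda>x. x ^ Suc k / fact (Suc k)) has_field_derivative x ^ k / fact k) (at x)"
        using DERIV_cdivide[OF DERIV_pow[of "Suc k" x], of "fact (Suc k)"]
        by (simp del: of_nat_Suc power_Suc)
      from has_vector_derivative_scaleR[OF this has_vector_derivative_const[of "D (Suc k) t0"]]
      show ?thesis by simp
    qed
    have 3: "((\<lambda>x. (x ^ 0 / fact 0) *\<^sub>R D 0 t0) has_vector_derivative 0) (at x)"
      by simp
    have 4: "((\<lambda>x. \<Sum>k<n. (x ^ Suc k / fact (Suc k)) *\<^sub>R D (Suc k) t0) has_vector_derivative
        (\<Sum>k<n. (x ^ k / fact k) *\<^sub>R D (Suc k) t0)) (at x)"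
      by (intro has_vector_derivative_sum 2)
    show ?thesis
      unfolding R_def R'_def sum.lessThan_Suc_shift
      using has_vector_derivative_diff[OF 1 has_vector_derivative_add[OF 3 4]]
      by simp
  qed
  have "norm (R x) \<le> \<bar>C\<bar> * \<bar>x\<bar> ^ Suc n" if x: "\<bar>x\<bar> < min d e" for x
  proof -
    \<comment> \<open>On the ball of radius \<open>\<bar>x\<bar>\<close> the derivative
      \<open>R'\<close> is at most \<open>\<bar>C\<bar> * \<bar>x\<bar> ^ n\<close>; the length of
      the segment supplies the missing power.\<close>
    have "norm (R x - R 0) \<le> (\<bar>C\<bar> * \<bar>x\<bar> ^ n) * norm (x - 0)"
    proof (rule differentiable_bound[of "cball 0 \<bar>x\<bar>" R "\<lambda>z t. t *\<^sub>R R' z"])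
      fix z :: real assume z: "z \<in> cball 0 \<bar>x\<bar>"
      show "(R has_derivative (\<lambda>t. t *\<^sub>R R' z)) (at z within cball 0 \<bar>x\<bar>)"
        using deriv[of z] z x unfolding has_vector_derivative_def
        by (auto intro: has_derivative_at_withinI)
      have "norm (R' z) \<le> C * \<bar>z\<bar> ^ n"
        using C[of z] z x unfolding R'_def by auto
      also have "\<dots> \<le> \<bar>C\<bar> * \<bar>x\<bar> ^ n"
        using z by (intro mult_mono power_mono) auto
      finally show "onorm (\<lambda>t. t *\<^sub>R R' z) \<le> \<bar>C\<bar> * \<bar>x\<bar> ^ n"
        by (intro onorm_le) (simp add: mult_right_mono mult.commute mult_left_mono)
    qed auto
    thus ?thesis using R0 by (simp add: mult_ac)
  qed
  thus ?case unfolding R_def using d e(1) by (intro exI[of _ "\<bar>C\<bar>"] exI[of _ "min d e"]) auto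
qed

lemma taylor_remainder:
  fixes D :: "nat \<Rightarrow> real \<Rightarrow> 'a::real_normed_vector"
  assumes "open S" "t0 \<in> S"
    and "\<And>k t. k < n \<Longrightarrow> t \<in> S \<Longrightarrow> (D k has_vector_derivative D (Suc k) t) (at t)"
    and "continuous_on S (D n)"
  shows "remainder n (\<lambda>h. D 0 (t0 + c * h) - (\<Sum>k<n. ((c * h) ^ k / fact k) *\<^sub>R D k t0))"
proof -
  obtain C d where d: "d > 0" and C: "\<And>x. \<bar>x\<bar> < d \<Longrightarrow>
      norm (D 0 (t0 + x) - (\<Sum>k<n. (x ^ k / fact k) *\<^sub>R D k t0)) \<le> C * \<bar>x\<bar> ^ n"
    using taylor_local_bound[where D = D, OF assms] by blast
  have "((\<lambda>h. c * h) \<longlongrightarrow> c * 0) (at_right 0)"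
    by (intro tendsto_intros)
  hence "\<forall>\<^sub>F h in at_right 0. \<bar>c * h\<bar> < d"
    using d by (simp add: tendsto_iff dist_norm)
  moreover have "\<forall>\<^sub>F h in at_right (0::real). 0 < h"
    by (rule eventually_at_right_less)
  ultimately have "\<forall>\<^sub>F h in at_right 0.
      norm (D 0 (t0 + c * h) - (\<Sum>k<n. ((c * h) ^ k / fact k) *\<^sub>R D k t0)) \<le> (C * \<bar>c\<bar> ^ n) * h ^ n"
  proof eventually_elim
    case (elim h)
    thus ?case using C[of "c * h"] by (simp add: abs_mult power_mult_distrib mult_ac)
  qed
  thus ?thesis unfolding remainder_def by blast
qed

section \<open>Smoothness along solutions\<close>

lemma time_deriv_0 [simp]: "time_deriv 0 \<phi> = \<phi>"
  by (simp add: time_deriv_def)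

text \<open>Peels off the innermost derivative, so that inductions can pass from
  \<open>\<phi>\<close> to its derivative.\<close>

lemma time_deriv_Suc: "time_deriv (Suc k) \<phi> = time_deriv k (\<lambda>t. vector_derivative \<phi> (at t))"
  by (simp add: time_deriv_def funpow_Suc_right del: funpow.simps)

text \<open>The derivative is an existential witness instead of \<open>vector_derivative\<close>, so
  that sum, product and chain rules deliver it directly; \<open>cont_diff_time_deriv\<close>
  converts back to iterated derivatives.\<close>

primrec cont_diff :: "nat \<Rightarrow> real set \<Rightarrow> (real \<Rightarrow> 'a::real_normed_vector) \<Rightarrow> bool" where
  "cont_diff 0 S \<phi> \<longleftrightarrow> continuous_on S \<phi>"
| "cont_diff (Suc n) S \<phi> \<longleftrightarrow>
     (\<exists>\<phi>'. (\<forall>t\<in>S. (\<phi> has_vector_derivative \<phi>' t) (at t)) \<and> cont_diff n S \<phi>')"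

lemma cont_diff_imp_continuous_on:
  "cont_diff n S \<phi> \<Longrightarrow> continuous_on S \<phi>"
proof (cases n)
  case (Suc m)
  assume "cont_diff n S \<phi>"
  then obtain \<phi>' where "\<And>t. t \<in> S \<Longrightarrow> (\<phi> has_vector_derivative \<phi>' t) (at t)"
    unfolding Suc by auto
  thus ?thesis
    by (meson continuous_at_imp_continuous_on has_vector_derivative_continuous)
qed simp

lemma cont_diff_SucD: "cont_diff (Suc n) S \<phi> \<Longrightarrow> cont_diff n S \<phi>"
proof (induction n arbitrary: \<phi>)
  case 0
  then show ?case using cont_diff_imp_continuous_on cont_diff.simps(1) by blast
next
  case (Suc n)
  then obtain \<phi>' where "\<And>t. t \<in> S \<Longrightarrow> (\<phi> has_vector_derivative \<phi>' t) (at t)" "cont_diff (Suc n) S \<phi>'"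
    by auto
  with Suc.IH[of \<phi>'] show ?case by auto
qed

lemma cont_diff_cong:
  assumes "open S" "\<And>t. t \<in> S \<Longrightarrow> \<phi> t = \<psi> t" "cont_diff n S \<phi>"
  shows "cont_diff n S \<psi>"
proof (cases n)
  case 0
  then show ?thesis using assms continuous_on_cong by (metis cont_diff.simps(1))
next
  case (Suc m)
  then obtain \<phi>' where \<phi>': "\<And>t. t \<in> S \<Longrightarrow> (\<phi> has_vector_derivative \<phi>' t) (at t)" "cont_diff m S \<phi>'"
    using assms(3) by auto
  have "(\<psi> has_vector_derivative \<phi>' t) (at t)" if "t \<in> S" for t
    by (rule has_vector_derivative_transform_within_open[OF \<phi>'(1)[OF that] assms(1) that])
       (use assms(2) in auto)
  thus ?thesis using \<phi>'(2) Suc by auto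
qed

lemma cont_diff_add:
  "cont_diff n S \<phi> \<Longrightarrow> cont_diff n S \<psi> \<Longrightarrow> cont_diff n S (\<lambda>t. \<phi> t + \<psi> t)"
proof (induction n arbitrary: \<phi> \<psi>)
  case 0
  then show ?case by (auto intro: continuous_intros)
next
  case (Suc n)
  obtain \<phi>' where 1: "\<forall>t\<in>S. (\<phi> has_vector_derivative \<phi>' t) (at t)" "cont_diff n S \<phi>'"
    using Suc.prems(1) by auto
  obtain \<psi>' where 2: "\<forall>t\<in>S. (\<psi> has_vector_derivative \<psi>' t) (at t)" "cont_diff n S \<psi>'"
    using Suc.prems(2) by auto
  show ?case
    using 1 2 Suc.IH[of \<phi>' \<psi>'] by (auto intro!: exI[of _ "\<lambda>t. \<phi>' t + \<psi>' t"] has_vector_derivative_add)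
qed

lemma cont_diff_zero: "cont_diff n S (\<lambda>_. 0)"
  by (induction n) (auto intro!: exI[of _ "\<lambda>_. 0"])

lemma cont_diff_sum:
  "(\<And>i. i \<in> I \<Longrightarrow> cont_diff n S (\<phi> i)) \<Longrightarrow> cont_diff n S (\<lambda>t. \<Sum>i\<in>I. \<phi> i t)"
  by (induction I rule: infinite_finite_induct) (auto intro: cont_diff_add cont_diff_zero)

lemma cont_diff_bilinear:
  assumes "bounded_bilinear bop"
  shows "cont_diff n S \<phi> \<Longrightarrow> cont_diff n S \<psi> \<Longrightarrow> cont_diff n S (\<lambda>t. bop (\<phi> t) (\<psi> t))"
proof (induction n arbitrary: \<phi> \<psi>)
  case 0
  then show ?case by (auto intro: bounded_bilinear.continuous_on[OF assms])
next
  case (Suc n)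
  obtain \<phi>' where 1: "\<forall>t\<in>S. (\<phi> has_vector_derivative \<phi>' t) (at t)" "cont_diff n S \<phi>'"
    using Suc.prems(1) by auto
  obtain \<psi>' where 2: "\<forall>t\<in>S. (\<psi> has_vector_derivative \<psi>' t) (at t)" "cont_diff n S \<psi>'"
    using Suc.prems(2) by auto
  \<comment> \<open>Each summand of the product rule has one undifferentiated factor, which is
    lowered from class \<open>Suc n\<close> to \<open>n\<close> before the induction hypothesis
    applies.\<close>
  have "cont_diff n S (\<lambda>t. bop (\<phi> t) (\<psi>' t) + bop (\<phi>' t) (\<psi> t))"
    by (rule cont_diff_add[OF Suc.IH[OF cont_diff_SucD[OF Suc.prems(1)] 2(2)]
          Suc.IH[OF 1(2) cont_diff_SucD[OF Suc.prems(2)]]])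
  moreover have "((\<lambda>t. bop (\<phi> t) (\<psi> t)) has_vector_derivative
      bop (\<phi> t) (\<psi>' t) + bop (\<phi>' t) (\<psi> t)) (at t)" if "t \<in> S" for t
    using 1 2 that by (intro bounded_bilinear.has_vector_derivative[OF assms]) auto
  ultimately show ?case
    by (auto intro!: exI[of _ "\<lambda>t. bop (\<phi> t) (\<psi>' t) + bop (\<phi>' t) (\<psi> t)"])
qed

lemma cont_diff_const: "cont_diff n S (\<lambda>_. c)"
  by (cases n) (auto intro!: exI[of _ "\<lambda>_. 0"] cont_diff_zero)

lemma cont_diff_time_deriv:
  assumes "open S"
  shows "cont_diff n S \<phi> \<Longrightarrow> k < n \<Longrightarrow> t \<in> S \<Longrightarrow>
           (time_deriv k \<phi> has_vector_derivative time_deriv (Suc k) \<phi> t) (at t)"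
    and "cont_diff n S \<phi> \<Longrightarrow> continuous_on S (time_deriv n \<phi>)"
proof -
  have "(\<forall>k<n. \<forall>t\<in>S. (time_deriv k \<phi> has_vector_derivative time_deriv (Suc k) \<phi> t) (at t)) \<and>
        continuous_on S (time_deriv n \<phi>)" if "cont_diff n S \<phi>" for \<phi> :: "real \<Rightarrow> 'a"
    using that
  proof (induction n arbitrary: \<phi>)
    case (Suc n)
    define \<psi> where "\<psi> = (\<lambda>t. vector_derivative \<phi> (at t))"
    obtain \<phi>' where \<phi>': "\<And>t. t \<in> S \<Longrightarrow> (\<phi> has_vector_derivative \<phi>' t) (at t)" "cont_diff n S \<phi>'"
      using Suc.prems by auto
    hence eq: "\<phi>' t = \<psi> t" if "t \<in> S" for t
      using that unfolding \<psi>_def by (metis vector_derivative_at)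
    \<comment> \<open>The witness and \<open>vector_derivative\<close> agree only on
      \<open>S\<close>; openness of \<open>S\<close> makes that enough to transfer all further
      derivatives.\<close>
    have "cont_diff n S \<psi>"
      using cont_diff_cong[OF assms eq \<phi>'(2)] .
    note IH = Suc.IH[OF this]
    have shift: "time_deriv (Suc k) \<phi> = time_deriv k \<psi>" for k
      unfolding \<psi>_def time_deriv_Suc ..
    have "(time_deriv k \<phi> has_vector_derivative time_deriv (Suc k) \<phi> t) (at t)"
      if "k < Suc n" "t \<in> S" for k t
      using that IH \<phi>'(1)[of t] eq[of t] shift by (cases k) (auto simp: shift)
    thus ?case using IH shift by auto
  qed simp
  thus "cont_diff n S \<phi> \<Longrightarrow> k < n \<Longrightarrow> t \<in> S \<Longrightarrow>
           (time_deriv k \<phi> has_vector_derivative time_deriv (Suc k) \<phi> t) (at t)"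
    and "cont_diff n S \<phi> \<Longrightarrow> continuous_on S (time_deriv n \<phi>)"
    by auto
qed

section \<open>Functions of class C^n on the phase space and their values along solutions\<close>

lemma C_class_imp_continuous: "C_class n f \<Longrightarrow> continuous_on UNIV f"
  by (cases n) (auto simp: differentiable_imp_continuous_within continuous_on_eq_continuous_within)

lemma C_class_SucD: "C_class (Suc n) f \<Longrightarrow> C_class n f"
proof (induction n arbitrary: f)
  case 0
  then show ?case using C_class_imp_continuous C_class.simps(1) by blast
next
  case (Suc n)
  thus ?case using C_class.simps(2) by metis
qed

lemma C_class_mono: "m \<le> n \<Longrightarrow> C_class n f \<Longrightarrow> C_class m f"
  by (induction n rule: dec_induct) (auto dest: C_class_SucD simp del: C_class.simps)

text \<open>Bootstrapping: the solution is only assumed differentiable, but its velocity is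
  \<open>f (y t) + g (y t)\<close>. With \<open>F\<close> arbitrary, the induction hypothesis
  applies to \<open>f\<close>, to \<open>g\<close> and to the directional derivatives of
  \<open>F\<close>, which together make up the derivative of \<open>F (y t)\<close>.\<close>

lemma C_class_compose_solution:
  fixes F :: "'a::euclidean_space \<Rightarrow> 'a"
  assumes "\<And>t. t \<in> S \<Longrightarrow> (y has_vector_derivative f (y t) + g (y t)) (at t)"
    and "C_class n f" "C_class n g" "C_class n F"
  shows "cont_diff n S (\<lambda>t. F (y t))"
  using assms(2-)
proof (induction n arbitrary: F)
  case 0
  have "continuous_on S y"
    using assms(1) by (meson continuous_at_imp_continuous_on has_vector_derivative_continuous)
  thus ?case using 0 continuous_on_compose2[of UNIV F S y] by auto
next
  case (Suc n)
  define v where "v t = f (y t) + g (y t)" for t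
  define dF where "dF t b = frechet_derivative F (at (y t)) b" for t b
  have Fdiff: "(F has_derivative frechet_derivative F (at x)) (at x)" for x
    using Suc.prems(3) frechet_derivative_works by auto
  have lin: "linear (frechet_derivative F (at x))" for x
    using Fdiff has_derivative_linear by blast
  note fg = C_class_SucD[OF Suc.prems(1)] C_class_SucD[OF Suc.prems(2)]
  have "cont_diff n S (\<lambda>t. f (y t))" "cont_diff n S (\<lambda>t. g (y t))"
    by (intro Suc.IH fg)+
  hence "cont_diff n S v"
    unfolding v_def by (rule cont_diff_add)
  moreover have "cont_diff n S (\<lambda>t. dF t b)" for b
    unfolding dF_def 
    by (rule Suc.IH[OF fg]) (use Suc.prems(3) in simp)
  \<comment> \<open>\<open>C_class\<close> controls derivatives in fixed directions only, so the
    derivative in the moving direction \<open>v t\<close> is expanded over the basis.\<close>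
  ultimately have "cont_diff n S (\<lambda>t. \<Sum>b\<in>Basis. (v t \<bullet> b) *\<^sub>R dF t b)"
    by (intro cont_diff_sum cont_diff_bilinear[OF bounded_bilinear_scaleR]
          cont_diff_bilinear[OF bounded_bilinear_inner] cont_diff_const)
  moreover have "((\<lambda>t. F (y t)) has_vector_derivative (\<Sum>b\<in>Basis. (v t \<bullet> b) *\<^sub>R dF t b)) (at t)"
    if "t \<in> S" for t
  proof -
    have "((F \<circ> y) has_vector_derivative frechet_derivative F (at (y t)) (v t)) (at t)"
      by (rule vector_derivative_diff_chain_within[of y "v t" t UNIV F])
         (use assms(1)[OF that] Fdiff in \<open>auto simp: v_def intro: has_derivative_at_withinI\<close>)
    moreover have "frechet_derivative F (at (y t)) (v t) = (\<Sum>b\<in>Basis. (v t \<bullet> b) *\<^sub>R dF t b)"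
      unfolding dF_def using lin[of "y t"]
      by (subst euclidean_representation[of "v t", symmetric])
         (simp only: linear_sum linear_scale)
    ultimately show ?thesis by (simp add: o_def)
  qed
  ultimately show ?case
    by (auto intro!: exI[of _ "\<lambda>t. \<Sum>b\<in>Basis. (v t \<bullet> b) *\<^sub>R dF t b"])
qed

text \<open>The partial derivatives are continuous, hence bounded on the compact ball; their bounds
  add up to a bound on the operator norm, and convexity of the ball gives the Lipschitz estimate.
  Only a local constant can be expected, which is where boundedness of the stages is used
  later.\<close>

lemma C_class_lipschitz_cball:
  fixes F :: "'a::euclidean_space \<Rightarrow> 'b::euclidean_space"
  assumes "C_class 1 F"
  obtains L where "L \<ge> 0"
    "\<And>x z. norm x \<le> R \<Longrightarrow> norm z \<le> R \<Longrightarrow> norm (F x - F z) \<le> L * norm (x - z)"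
proof -
  let ?D = "\<lambda>x b. frechet_derivative F (at x) b"
  have Fdiff: "(F has_derivative ?D x) (at x)" for x
    using assms frechet_derivative_works by auto
  have "\<exists>B. \<forall>x\<in>cball 0 R. norm (?D x b) \<le> B" for b
  proof -
    have "continuous_on (cball 0 R) (\<lambda>x. ?D x b)"
      using assms by (auto intro: continuous_on_subset)
    hence "bounded ((\<lambda>x. ?D x b) ` cball 0 R)"
      using compact_continuous_image compact_imp_bounded compact_cball by blast
    thus ?thesis unfolding bounded_iff by auto
  qed
  then obtain B where B: "\<And>b x. norm x \<le> R \<Longrightarrow> norm (?D x b) \<le> B b"
    by (metis mem_cball_0)
  define L where "L = (\<Sum>b\<in>Basis. \<bar>B b\<bar>)"
  have "norm (F x - F z) \<le> L * norm (x - z)" if "norm x \<le> R" "norm z \<le> R" for x z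
  proof (rule differentiable_bound[of "cball 0 R" F ?D])
    fix u assume u: "u \<in> cball (0::'a) R"
    show "(F has_derivative ?D u) (at u within cball 0 R)"
      using Fdiff has_derivative_at_withinI by blast
    have lin: "linear (?D u)"
      using Fdiff has_derivative_linear by blast
    show "onorm (?D u) \<le> L"
    proof (rule onorm_le)
      fix v
      have "?D u v = (\<Sum>b\<in>Basis. (v \<bullet> b) *\<^sub>R ?D u b)"
        by (subst euclidean_representation[of v, symmetric])
           (simp only: linear_sum[OF lin] linear_scale[OF lin])
      also have "norm \<dots> \<le> (\<Sum>b\<in>Basis. \<bar>B b\<bar> * norm v)"
      proof (rule sum_norm_le)
        fix b :: 'a assume b: "b \<in> Basis"
        have "\<bar>v \<bullet> b\<bar> * norm (?D u b) \<le> norm v * \<bar>B b\<bar>"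
          using B[of u b] u Basis_le_norm[OF b, of v] by (intro mult_mono) auto
        thus "norm ((v \<bullet> b) *\<^sub>R ?D u b) \<le> \<bar>B b\<bar> * norm v"
          by (simp add: mult.commute)
      qed
      also have "\<dots> = L * norm v"
        unfolding L_def by (simp add: sum_distrib_right)
      finally show "norm (?D u v) \<le> L * norm v" .
    qed
  qed (use that in auto)
  moreover have "L \<ge> 0" unfolding L_def by (simp add: sum_nonneg)
  ultimately show ?thesis using that by blast
qed

lemma C_class_const: "C_class n (\<lambda>_. c)"
  by (induction n arbitrary: c) auto

text \<open>Stated for every \<open>n\<close>, as the smoothness demanded in the order definitions
  is not known in advance.\<close>

lemma C_class_scaleR: "C_class n (\<lambda>x. c *\<^sub>R x)"
proof (cases n)
  case 0
  then show ?thesis by (auto intro: continuous_intros)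
next
  case (Suc m)
  have "((\<lambda>x. c *\<^sub>R x) has_derivative (\<lambda>x. c *\<^sub>R x)) (at z)" for z :: 'a
    by (auto intro!: derivative_eq_intros)
  hence "frechet_derivative (\<lambda>x. c *\<^sub>R x) (at z) = (\<lambda>x. c *\<^sub>R x)" for z :: 'a
    using frechet_derivative_at by metis
  thus ?thesis unfolding Suc by (simp add: C_class_const)
qed

section \<open>The coefficient conditions in matrix form\<close>

lemma C_mat_carrier: "dim_vec c = m \<Longrightarrow> C_mat c n \<in> carrier_mat m n"
  by (simp add: C_mat_def)

lemma F_mat_carrier: "F_mat n \<in> carrier_mat n n"
  by (simp add: F_mat_def)

lemma K_mat_carrier: "K_mat n \<in> carrier_mat n n"
  by (simp add: K_mat_def)

lemma eq_mat_iff_index: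
  assumes "A \<in> carrier_mat m n" "B \<in> carrier_mat m n"
  shows "A = B \<longleftrightarrow> (\<forall>i<m. \<forall>j<n. A $$ (i, j) = B $$ (i, j))"
  using assms by (auto simp: mat_eq_iff)

lemma mult_mat_index:
  assumes "A \<in> carrier_mat m n" "B \<in> carrier_mat n l" "i < m" "j < l"
  shows "(A * B) $$ (i, j) = (\<Sum>k<n. A $$ (i, k) * B $$ (k, j))"
  using assms by (auto simp: scalar_prod_def lessThan_atLeast0 intro!: sum.cong)

text \<open>A kernel vector of the scaled Vandermonde matrix is the coefficient vector of a polynomial
  of degree below \<open>s\<close> with \<open>s\<close> distinct roots.\<close>

lemma det_C_mat_nonzero:
  fixes c :: "real vec"
  assumes "dim_vec c = s" "inj_on (\<lambda>i. c $ i) {..<s}"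
  shows "det (C_mat c s) \<noteq> 0"
proof
  assume "det (C_mat c s) = 0"
  then obtain v where v: "v \<in> carrier_vec s" "v \<noteq> 0\<^sub>v s" "C_mat c s *\<^sub>v v = 0\<^sub>v s"
    using det_0_iff_vec_prod_zero_field[OF C_mat_carrier[OF assms(1), of s]] by blast
  define p where "p = (\<Sum>j<s. monom (v $ j / fact j) j)"
  have coeff_p: "coeff p j = (if j < s then v $ j / fact j else 0)" for j
    unfolding p_def by (simp add: coeff_sum)
  have root: "poly p (c $ i) = 0" if "i < s" for i
  proof -
    have "poly p (c $ i) = (\<Sum>j<s. C_mat c s $$ (i, j) * v $ j)"
      using that assms(1) unfolding p_def
      by (auto simp: poly_sum poly_monom C_mat_def intro!: sum.cong)
    also have "\<dots> = (C_mat c s *\<^sub>v v) $ i"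
      using that v(1) assms(1)
      by (auto simp: scalar_prod_def C_mat_def lessThan_atLeast0 intro!: sum.cong)
    finally show ?thesis using v(3) that by simp
  qed
  have "p = 0"
  proof (rule ccontr)
    assume "p \<noteq> 0"
    have "s > 0" using coeff_p \<open>p \<noteq> 0\<close> by (metis leading_coeff_0_iff not_gr_zero not_less_zero)
    have "degree p < s"
      using coeff_p \<open>p \<noteq> 0\<close> by (metis leading_coeff_0_iff)
    have "s = card ((\<lambda>i. c $ i) ` {..<s})"
      using card_image[OF assms(2)] by simp
    also have "\<dots> \<le> card {x. poly p x = 0}"
      using poly_roots_finite[OF \<open>p \<noteq> 0\<close>] root by (intro card_mono) auto
    also have "\<dots> \<le> degree p"
      using card_poly_roots_bound[OF \<open>p \<noteq> 0\<close>] .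
    finally show False using \<open>degree p < s\<close> by simp
  qed
  hence "v $ j = 0" if "j < s" for j
    using coeff_p[of j] that by simp
  hence "v = 0\<^sub>v s" using v(1) by auto
  with v(2) show False ..
qed

lemma inv_mat_inverse:
  assumes "A \<in> carrier_mat n n" "det A \<noteq> 0"
  shows "inv_mat A \<in> carrier_mat n n" "A * inv_mat A = 1\<^sub>m n" "inv_mat A * A = 1\<^sub>m n"
proof -
  obtain B where B: "mat_inverse A = Some B"
    using mat_inverse(1)[OF assms(1), of "()"] det_non_zero_imp_unit[OF assms, of "()"]
    by (cases "mat_inverse A") auto
  show "inv_mat A \<in> carrier_mat n n" "A * inv_mat A = 1\<^sub>m n" "inv_mat A * A = 1\<^sub>m n"
    using mat_inverse(2)[OF assms(1) B] B by (auto simp: inv_mat_def)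
qed

lemma eq_mult_inv_mat_iff:
  assumes "A \<in> carrier_mat n n" "det A \<noteq> 0" "X \<in> carrier_mat m n" "Y \<in> carrier_mat m n"
  shows "X = Y * inv_mat A \<longleftrightarrow> X * A = Y"
proof -
  note I = inv_mat_inverse[OF assms(1,2)]
  have "Y * inv_mat A * A = Y"
    using assoc_mult_mat[OF assms(4) I(1) assms(1)] I(3) right_mult_one_mat[OF assms(4)] by simp
  moreover have "X * A * inv_mat A = X"
    using assoc_mult_mat[OF assms(3,1) I(1)] I(2) right_mult_one_mat[OF assms(3)] by simp
  ultimately show ?thesis by auto
qed

text \<open>Both matrices are polynomials in the nilpotent shift: \<open>F\<close> is the sum of K^j
  / (j+1)!.\<close>

lemma K_F_commute: "K_mat n * F_mat n = F_mat n * K_mat n"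
proof (rule eq_matI)
  fix i j assume "i < dim_row (F_mat n * K_mat n)" "j < dim_col (F_mat n * K_mat n)"
  hence ij: "i < n" "j < n" by (simp_all add: F_mat_def K_mat_def)
  have "(K_mat n * F_mat n) $$ (i, j) = (\<Sum>k<n. if k = i + 1 then F_mat n $$ (k, j) else 0)"
    unfolding mult_mat_index[OF K_mat_carrier F_mat_carrier ij]
    using ij by (intro sum.cong refl) (auto simp: K_mat_def)
  \<comment> \<open>\<open>K\<close> shifts rows up from the left and columns to the right from the
    right; either way the entry of \<open>F\<close> moves one diagonal up, to 1/(j-i)! for i <
    j.\<close>
  also have "\<dots> = (if i + 1 < j + 1 then 1 / fact (j - i) else 0)"
    using ij by (auto simp: F_mat_def Suc_diff_Suc simp del: fact_Suc)
  also have "\<dots> = (\<Sum>k<n. if k + 1 = j then F_mat n $$ (i, k) else 0)"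
    using ij by (cases j) (auto simp: F_mat_def Suc_diff_le simp del: fact_Suc)
  also have "\<dots> = (F_mat n * K_mat n) $$ (i, j)"
    unfolding mult_mat_index[OF F_mat_carrier K_mat_carrier ij]
    using ij by (intro sum.cong refl) (auto simp: K_mat_def)
  finally show "(K_mat n * F_mat n) $$ (i, j) = (F_mat n * K_mat n) $$ (i, j)" .
qed (simp_all add: F_mat_def K_mat_def)

text \<open>Multiplication by \<open>K\<close> differentiates the Taylor coefficients in
  \<open>c\<close>, with 0 in column 0.\<close>

lemma C_mat_K_mat_index:
  fixes c :: "real vec"
  assumes "dim_vec c = s" "i < s" "j < n"
  shows "(C_mat c n * K_mat n) $$ (i, j) = (if j = 0 then 0 else (c $ i) ^ (j - 1) / fact (j - 1))"
proof -
  have "(C_mat c n * K_mat n) $$ (i, j) =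
          (\<Sum>k<n. if k + 1 = j then (c $ i) ^ k / fact k else 0)"
    unfolding mult_mat_index[OF C_mat_carrier[OF assms(1)] K_mat_carrier assms(2,3)]
    using assms by (intro sum.cong refl) (auto simp: K_mat_def C_mat_def)
  also have "\<dots> = (if j = 0 then 0 else (c $ i) ^ (j - 1) / fact (j - 1))"
    using assms(3) by (cases j) auto
  finally show ?thesis .
qed

text \<open>\<open>X\<close> has only \<open>s\<close> columns: the change of the term with weight
  index \<open>s\<close> over one step is already of order h^(s+1), so that weight does not
  enter.\<close>

lemma output_condition_iff:
  fixes c :: "real vec"
  assumes "dim_vec c = s" "B \<in> carrier_mat s s" "X \<in> carrier_mat s s"
    and "\<And>i k. i < s \<Longrightarrow> k < s \<Longrightarrow> X $$ (i, k) = w i k"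
  shows "(\<forall>i<s. \<forall>n<s. (\<Sum>k\<le>n. w i k / fact (Suc n - k)) =
            (\<Sum>j<s. B $$ (i, j) * (c $ j) ^ n / fact n)) \<longleftrightarrow>
         B * C_mat c s = X * F_mat s"
proof -
  have BC: "(B * C_mat c s) $$ (i, n) = (\<Sum>j<s. B $$ (i, j) * (c $ j) ^ n / fact n)"
    if "i < s" "n < s" for i n
    unfolding mult_mat_index[OF assms(2) C_mat_carrier[OF assms(1)] that]
    using that assms(1) by (intro sum.cong refl) (auto simp: C_mat_def)
  have XF: "(X * F_mat s) $$ (i, n) = (\<Sum>k\<le>n. w i k / fact (Suc n - k))"
    if "i < s" "n < s" for i n
  proof -
    have "(X * F_mat s) $$ (i, n) = (\<Sum>k<s. if k \<le> n then w i k / fact (Suc n - k) else 0)"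
      unfolding mult_mat_index[OF assms(3) F_mat_carrier that]
      using that assms(4) by (intro sum.cong refl) (auto simp: F_mat_def Suc_diff_le simp del: fact_Suc)
    also have "\<dots> = (\<Sum>k\<le>n. w i k / fact (Suc n - k))"
      using that by (intro sum.mono_neutral_cong_right) auto
    finally show ?thesis .
  qed
  have "B * C_mat c s = X * F_mat s \<longleftrightarrow>
      (\<forall>i<s. \<forall>n<s. (B * C_mat c s) $$ (i, n) = (X * F_mat s) $$ (i, n))"
    by (rule eq_mat_iff_index[OF mult_carrier_mat[OF assms(2) C_mat_carrier[OF assms(1)]]
          mult_carrier_mat[OF assms(3) F_mat_carrier]])
  thus ?thesis using BC XF by auto
qed

text \<open>The parameter \<open>l\<close> is \<open>0\<close> for the explicit and \<open>lam\<close> for the implicit coefficients. The second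
  conjunct is column \<open>n + 1\<close> of \<open>W (E - I) = B C K\<close>, whose column \<open>0\<close> is vacuous.\<close>

definition coeff_conditions :: "nat \<Rightarrow> real \<Rightarrow> real vec \<Rightarrow>
    (nat \<Rightarrow> nat \<Rightarrow> real) \<Rightarrow> (nat \<Rightarrow> nat \<Rightarrow> real) \<Rightarrow> bool" where
  "coeff_conditions s l c w b \<longleftrightarrow>
     (\<forall>i<s. \<forall>k\<le>s. w i k = (c $ i) ^ k / fact k -
        l * (if k = 0 then 0 else (c $ i) ^ (k - 1) / fact (k - 1))) \<and>
     (\<forall>i<s. \<forall>n<s. (\<Sum>k\<le>n. w i k / fact (Suc n - k)) = (\<Sum>j<s. b i j * (c $ j) ^ n / fact n))"

lemma coeff_conditions_iff_mat:
  fixes c :: "real vec"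
  assumes "dim_vec c = s" "inj_on (\<lambda>i. c $ i) {..<s}"
    and "W \<in> carrier_mat s (s + 1)" "B \<in> carrier_mat s s"
  shows "coeff_conditions s l c (\<lambda>i k. W $$ (i, k)) (\<lambda>i j. B $$ (i, j)) \<longleftrightarrow>
           W = C_mat c (s + 1) - l \<cdot>\<^sub>m (C_mat c (s + 1) * K_mat (s + 1)) \<and>
           B = C_mat c s * F_mat s * (1\<^sub>m s - l \<cdot>\<^sub>m K_mat s) * inv_mat (C_mat c s)"
proof -
  note C = C_mat_carrier[OF assms(1)]
  let ?w = "\<lambda>i k. (c $ i) ^ k / fact k - l * (if k = 0 then 0 else (c $ i) ^ (k - 1) / fact (k - 1))"
  let ?V = "C_mat c (s + 1) - l \<cdot>\<^sub>m (C_mat c (s + 1) * K_mat (s + 1))"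
  let ?X = "C_mat c s - l \<cdot>\<^sub>m (C_mat c s * K_mat s)"
  have carr: "?X \<in> carrier_mat s s" "?V \<in> carrier_mat s (s + 1)"
    by (intro minus_carrier_mat smult_carrier_mat mult_carrier_mat[OF C K_mat_carrier])+
  have V: "?V $$ (i, k) = ?w i k" if "i < s" "k < s + 1" for i k
    using that C[of "s + 1"] K_mat_carrier[of "s + 1"] C_mat_K_mat_index[OF assms(1) that]
    by (simp add: C_mat_def assms(1))
  have X: "?X $$ (i, k) = ?w i k" if "i < s" "k < s" for i k
    using that C[of s] K_mat_carrier[of s] C_mat_K_mat_index[OF assms(1) that]
    by (simp add: C_mat_def assms(1))
  have "W = ?V \<longleftrightarrow> (\<forall>i<s. \<forall>k<s + 1. W $$ (i, k) = ?w i k)"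
    unfolding eq_mat_iff_index[OF assms(3) carr(2)]
    by (intro iff_allI imp_cong refl) (simp only: V)
  hence W: "W = ?V \<longleftrightarrow> (\<forall>i<s. \<forall>k\<le>s. W $$ (i, k) = ?w i k)"
    by (simp only: Suc_eq_plus1[symmetric] less_Suc_eq_le)
  have "?X * F_mat s = C_mat c s * F_mat s * (1\<^sub>m s - l \<cdot>\<^sub>m K_mat s)"
  proof -
    note F = F_mat_carrier[of s] and K = K_mat_carrier[of s]
    have CF: "C_mat c s * F_mat s \<in> carrier_mat s s" and CK: "C_mat c s * K_mat s \<in> carrier_mat s s"
      using C[of s] F K by auto
    have "?X * F_mat s = C_mat c s * F_mat s - l \<cdot>\<^sub>m (C_mat c s * K_mat s * F_mat s)"
      using C[of s] F K CK
      by (subst minus_mult_distrib_mat[of _ s s]) (auto simp: mult_smult_assoc_mat[of _ s s])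
    also have "C_mat c s * K_mat s * F_mat s = C_mat c s * F_mat s * K_mat s"
      using C[of s] F K K_F_commute[of s] by (simp add: assoc_mult_mat[of _ s s _ s _ s])
    also have "C_mat c s * F_mat s - l \<cdot>\<^sub>m (C_mat c s * F_mat s * K_mat s) =
        C_mat c s * F_mat s * (1\<^sub>m s - l \<cdot>\<^sub>m K_mat s)"
      using CF K by (subst mult_minus_distrib_mat[of _ s s]) (auto simp: mult_smult_distrib[of _ s s])
    finally show ?thesis .
  qed
  moreover have "C_mat c s * F_mat s * (1\<^sub>m s - l \<cdot>\<^sub>m K_mat s) \<in> carrier_mat s s"
    using C[of s] F_mat_carrier[of s] K_mat_carrier[of s] by auto
  ultimately have B: "B = C_mat c s * F_mat s * (1\<^sub>m s - l \<cdot>\<^sub>m K_mat s) * inv_mat (C_mat c s) \<longleftrightarrow>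
      B * C_mat c s = ?X * F_mat s"
    using eq_mult_inv_mat_iff[OF C det_C_mat_nonzero[OF assms(1,2)] assms(4)] by simp
  have out: "(\<forall>i<s. \<forall>n<s. (\<Sum>k\<le>n. ?w i k / fact (Suc n - k)) =
            (\<Sum>j<s. B $$ (i, j) * (c $ j) ^ n / fact n)) \<longleftrightarrow>
         B * C_mat c s = ?X * F_mat s"
    by (rule output_condition_iff[OF assms(1,4) carr(1) X])
  \<comment> \<open>The weight formula in the first conjunct may be assumed for the second, where it
    replaces \<open>W\<close> by its closed form.\<close>
  show ?thesis
    unfolding B W out[symmetric] coeff_conditions_def
    by (intro conj_cong refl) (auto intro!: sum.cong)
qed

lemma coeff_conditions_0_iff_mat:
  fixes c :: "real vec"
  assumes "dim_vec c = s" "inj_on (\<lambda>i. c $ i) {..<s}"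
    and "W \<in> carrier_mat s (s + 1)" "B \<in> carrier_mat s s"
  shows "coeff_conditions s 0 c (\<lambda>i k. W $$ (i, k)) (\<lambda>i j. B $$ (i, j)) \<longleftrightarrow>
           W = C_mat c (s + 1) \<and> B = C_mat c s * F_mat s * inv_mat (C_mat c s)"
proof -
  have "C_mat c (s + 1) - 0 \<cdot>\<^sub>m (C_mat c (s + 1) * K_mat (s + 1)) = C_mat c (s + 1)"
    by (rule eq_matI) (auto simp: C_mat_def K_mat_def)
  moreover have "1\<^sub>m s - 0 \<cdot>\<^sub>m K_mat s = 1\<^sub>m s"
    by (rule eq_matI) (auto simp: K_mat_def)
  moreover have "C_mat c s * F_mat s * 1\<^sub>m s = C_mat c s * F_mat s"
    using C_mat_carrier[OF assms(1), of s] F_mat_carrier[of s] by (intro right_mult_one_mat) auto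
  ultimately show ?thesis
    using coeff_conditions_iff_mat[OF assms, of 0] by simp
qed

section \<open>Expansion of one step\<close>

text \<open>Cauchy product of the weights with the exponential series. Cutting the expansion of the
  k-th derivative after h^(s-k) leaves exactly the triangle \<open>k + m \<le> s\<close>, and the
  inner sums are the columns of W E.\<close>

lemma truncated_product_reindex:
  fixes X :: "nat \<Rightarrow> 'a::real_vector"
  shows "(\<Sum>k\<le>s. h ^ k *\<^sub>R (w k *\<^sub>R (\<Sum>m<Suc s - k. (h ^ m / fact m) *\<^sub>R X (k + m)))) =
         (\<Sum>n\<le>s. h ^ n *\<^sub>R ((\<Sum>k\<le>n. w k / fact (n - k)) *\<^sub>R X n))"
proof -
  let ?g = "\<lambda>k m. (w k / fact m * h ^ (k + m)) *\<^sub>R X (k + m)"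
  have "(\<Sum>k\<le>s. h ^ k *\<^sub>R (w k *\<^sub>R (\<Sum>m<Suc s - k. (h ^ m / fact m) *\<^sub>R X (k + m)))) =
        (\<Sum>k\<le>s. \<Sum>m<Suc s - k. ?g k m)"
    by (simp add: scaleR_sum_right power_add mult_ac)
  also have "\<dots> = (\<Sum>(k, m)\<in>{(k, m). k + m \<le> s}. ?g k m)"
    by (subst sum.Sigma) (auto intro!: sum.cong)
  also have "\<dots> = (\<Sum>n\<le>s. \<Sum>k\<le>n. ?g k (n - k))"
    by (rule sum.triangle_reindex_eq)
  also have "\<dots> = (\<Sum>n\<le>s. h ^ n *\<^sub>R ((\<Sum>k\<le>n. w k / fact (n - k)) *\<^sub>R X n))"
    by (intro sum.cong refl) (simp add: scaleR_sum_left scaleR_sum_right mult_ac)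
  finally show ?thesis .
qed

text \<open>Both the sufficiency and the necessity of the output condition are read off this identity:
  it is the defect of the output stage after all Taylor expansions have been inserted.\<close>

lemma output_defect:
  fixes X :: "nat \<Rightarrow> 'a::real_vector"
  shows "h *\<^sub>R (\<Sum>j<r. b j *\<^sub>R (\<Sum>m<s. ((c j * h) ^ m / fact m) *\<^sub>R X (Suc m))) +
         (\<Sum>k\<le>s. h ^ k *\<^sub>R (w k *\<^sub>R X k)) -
         (\<Sum>k\<le>s. h ^ k *\<^sub>R (w k *\<^sub>R (\<Sum>m<Suc s - k. (h ^ m / fact m) *\<^sub>R X (k + m)))) =
         (\<Sum>m<s. h ^ Suc m *\<^sub>R (((\<Sum>j<r. b j * c j ^ m / fact m) -
            (\<Sum>k\<le>m. w k / fact (Suc m - k))) *\<^sub>R X (Suc m)))"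
proof -
  have 1: "h *\<^sub>R (\<Sum>j<r. b j *\<^sub>R (\<Sum>m<s. ((c j * h) ^ m / fact m) *\<^sub>R X (Suc m))) =
      (\<Sum>m<s. h ^ Suc m *\<^sub>R ((\<Sum>j<r. b j * c j ^ m / fact m) *\<^sub>R X (Suc m)))"
    unfolding scaleR_sum_right scaleR_sum_left
    by (subst sum.swap) (simp add: power_mult_distrib mult_ac)
  have 2: "(\<Sum>n\<le>s. h ^ n *\<^sub>R ((\<Sum>k\<le>n. w k / fact (n - k)) *\<^sub>R X n)) =
      (\<Sum>k\<le>s. h ^ k *\<^sub>R (w k *\<^sub>R X k)) +
      (\<Sum>m<s. h ^ Suc m *\<^sub>R ((\<Sum>k\<le>m. w k / fact (Suc m - k)) *\<^sub>R X (Suc m)))"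
    unfolding lessThan_Suc_atMost[symmetric] sum.lessThan_Suc_shift[of _ s]
    by (simp add: lessThan_Suc_atMost sum.distrib scaleR_add_left scaleR_add_right algebra_simps
          del: sum.lessThan_Suc power_Suc)
  show ?thesis
    unfolding truncated_product_reindex 1 2
    by (simp add: sum_subtractf scaleR_diff_left scaleR_diff_right del: power_Suc)
qed

text \<open>The factor \<open>h\<close> becomes an index shift, so the coefficients are those of a
  row of C K; this is the origin of the term \<open>lam\<close> C K in the implicit weights.\<close>

lemma taylor_polynomial_stage:
  fixes X :: "nat \<Rightarrow> 'a::real_vector"
  shows "h *\<^sub>R (\<Sum>m<s. ((c * h) ^ m / fact m) *\<^sub>R X (Suc m)) =
         (\<Sum>k\<le>s. h ^ k *\<^sub>R ((if k = 0 then 0 else c ^ (k - 1) / fact (k - 1)) *\<^sub>R X k))"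
  unfolding lessThan_Suc_atMost[symmetric] sum.lessThan_Suc_shift[of _ s]
  by (simp add: scaleR_sum_right power_mult_distrib mult_ac del: sum.lessThan_Suc)

text \<open>Slot 0 holds \<open>y\<close> in the explicit family and 0 in the implicit one, so the
  shared weight of index 0 counts once and the two families add up to the derivatives of
  \<open>y\<close>.\<close>

definition ext_deriv :: "(real \<Rightarrow> 'a::real_normed_vector) \<Rightarrow> (real \<Rightarrow> 'a) \<Rightarrow> nat \<Rightarrow> real \<Rightarrow> 'a" where
  "ext_deriv u \<phi> k t = (case k of 0 \<Rightarrow> u t | Suc m \<Rightarrow> time_deriv m \<phi> t)"

lemma ext_expansion_eq:
  "ext_expansion p M f g y t h i =
     (\<Sum>k\<le>p. h ^ k *\<^sub>R (glm_W M $$ (i, k) *\<^sub>R ext_deriv y (\<lambda>\<tau>. f (y \<tau>)) k t)) +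
     (\<Sum>k\<le>p. h ^ k *\<^sub>R (glm_What M $$ (i, k) *\<^sub>R ext_deriv (\<lambda>_. 0) (\<lambda>\<tau>. g (y \<tau>)) k t))"
  unfolding ext_expansion_def lessThan_Suc_atMost[symmetric] sum.lessThan_Suc_shift[of _ p]
  by (simp add: ext_deriv_def mult_ac sum.atLeast1_atMost_eq del: sum.lessThan_Suc)

lemma imex_glm_step_euler_iff:
  assumes "glm_A M = 0\<^sub>m s s" "glm_Ahat M = lam \<cdot>\<^sub>m 1\<^sub>m s" "glm_U M = 1\<^sub>m s" "glm_V M = 1\<^sub>m s"
  shows "imex_glm_step s s M f g h yin Y yout \<longleftrightarrow>
    (\<forall>i<s. Y i = (h * lam) *\<^sub>R g (Y i) + yin i) \<and>
    (\<forall>i<s. yout i = h *\<^sub>R (\<Sum>j<s. glm_B M $$ (i, j) *\<^sub>R f (Y j)) +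
                   h *\<^sub>R (\<Sum>j<s. glm_Bhat M $$ (i, j) *\<^sub>R g (Y j)) + yin i)"
proof -
  have A: "(\<Sum>j<i. glm_A M $$ (i, j) *\<^sub>R f (Y j)) = 0" if "i < s" for i
    using that assms(1) by (intro sum.neutral) auto
  have Ahat: "(\<Sum>j\<le>i. glm_Ahat M $$ (i, j) *\<^sub>R g (Y j)) = lam *\<^sub>R g (Y i)" if "i < s" for i
  proof -
    have "(\<Sum>j\<le>i. glm_Ahat M $$ (i, j) *\<^sub>R g (Y j)) = (\<Sum>j\<le>i. if j = i then lam *\<^sub>R g (Y i) else 0)"
      using that assms(2) by (intro sum.cong refl) auto
    thus ?thesis by simp
  qed
  have U: "(\<Sum>j<s. 1\<^sub>m s $$ (i, j) *\<^sub>R yin j) = yin i" if "i < s" for i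
  proof -
    have "(\<Sum>j<s. 1\<^sub>m s $$ (i, j) *\<^sub>R yin j) = (\<Sum>j<s. if j = i then yin i else 0)"
      using that by (intro sum.cong refl) auto
    thus ?thesis using that by simp
  qed
  show ?thesis
    unfolding imex_glm_step_def assms(3,4)
    by (simp add: A Ahat U sum.distrib scaleR_add_right del: index_one_mat cong: all_cong imp_cong)
qed

section \<open>Sufficiency\<close>

lemma solves_ode_near_cont_diff:
  assumes "solves_ode_near f g y t0" "C_class n f" "C_class n g"
  obtains S where "open S" "t0 \<in> S"
    "\<And>t. t \<in> S \<Longrightarrow> (y has_vector_derivative f (y t) + g (y t)) (at t)"
    "cont_diff n S (\<lambda>\<tau>. f (y \<tau>))" "cont_diff n S (\<lambda>\<tau>. g (y \<tau>))"
proof -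
  obtain a b where ab: "a < t0" "t0 < b"
      "\<And>t. t \<in> {a<..<b} \<Longrightarrow> (y has_vector_derivative f (y t) + g (y t)) (at t)"
    using assms(1) unfolding solves_ode_near_def by blast
  show thesis
    by (rule that[of "{a<..<b}", OF _ _ ab(3)
          C_class_compose_solution[OF ab(3) assms(2,3,2)]
          C_class_compose_solution[OF ab(3) assms(2,3,3)]])
       (use ab(1,2) in auto)
qed

text \<open>Slot 0 is excluded because \<open>u\<close> need not be an antiderivative of
  \<open>\<phi>\<close>; at that slot only the two families together form a chain of
  derivatives.\<close>

lemma ext_deriv_taylor:
  assumes "open S" "t0 \<in> S" "cont_diff s S \<phi>" "0 < k" "k \<le> Suc s"
  shows "remainder (Suc s - k) (\<lambda>h. ext_deriv u \<phi> k (t0 + c * h) -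
           (\<Sum>m<Suc s - k. ((c * h) ^ m / fact m) *\<^sub>R ext_deriv u \<phi> (k + m) t0))"
proof -
  obtain l where l: "k = Suc l" using assms(4) by (cases k) auto
  have "remainder (s - l) (\<lambda>h. time_deriv (l + 0) \<phi> (t0 + c * h) -
           (\<Sum>m<s - l. ((c * h) ^ m / fact m) *\<^sub>R time_deriv (l + m) \<phi> t0))"
    by (rule taylor_remainder[OF assms(1,2), where D = "\<lambda>m. time_deriv (l + m) \<phi>"])
       (use cont_diff_time_deriv[OF assms(1,3)] assms(5) l in auto)
  thus ?thesis by (simp add: l ext_deriv_def)
qed

text \<open>Since y' is the sum of two C^s functions, \<open>y\<close> can be expanded one order
  further than either of them.\<close>

lemma solution_taylor:
  assumes "open S" "t0 \<in> S"
    and "\<And>t. t \<in> S \<Longrightarrow> (y has_vector_derivative \<phi> t + \<psi> t) (at t)"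
    and "cont_diff s S \<phi>" "cont_diff s S \<psi>"
  shows "remainder (Suc s) (\<lambda>h. y (t0 + c * h) -
           (\<Sum>m<Suc s. ((c * h) ^ m / fact m) *\<^sub>R
              (ext_deriv y \<phi> m t0 + ext_deriv (\<lambda>_. 0) \<psi> m t0)))"
proof -
  define D where "D m t = ext_deriv y \<phi> m t + ext_deriv (\<lambda>_. 0) \<psi> m t" for m t
  have "remainder (Suc s) (\<lambda>h. D 0 (t0 + c * h) - (\<Sum>m<Suc s. ((c * h) ^ m / fact m) *\<^sub>R D m t0))"
  proof (rule taylor_remainder[OF assms(1,2)])
    fix m t assume "m < Suc s" "t \<in> S"
    thus "(D m has_vector_derivative D (Suc m) t) (at t)"
      unfolding D_def ext_deriv_def
      using assms(3) cont_diff_time_deriv(1)[OF assms(1,4)] cont_diff_time_deriv(1)[OF assms(1,5)]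
      by (cases m) (auto intro!: has_vector_derivative_add)
  next
    show "continuous_on S (D (Suc s))"
      unfolding D_def ext_deriv_def
      using cont_diff_time_deriv(2)[OF assms(1,4)] cont_diff_time_deriv(2)[OF assms(1,5)]
      by (auto intro!: continuous_on_add)
  qed
  thus ?thesis unfolding D_def by (simp add: ext_deriv_def)
qed

lemma remainder_compose_lipschitz:
  fixes F :: "'a::euclidean_space \<Rightarrow> 'b::euclidean_space"
  assumes "C_class 1 F" "\<forall>\<^sub>F h in at_right 0. norm (u h) \<le> R" "\<forall>\<^sub>F h in at_right 0. norm (v h) \<le> R"
  shows "\<exists>L\<ge>0. \<forall>\<^sub>F h in at_right (0::real). norm (F (u h) - F (v h)) \<le> L * norm (u h - v h)"
proof -
  obtain L where L: "L \<ge> 0"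
    "\<And>x z. norm x \<le> R \<Longrightarrow> norm z \<le> R \<Longrightarrow> norm (F x - F z) \<le> L * norm (x - z)"
    using C_class_lipschitz_cball[OF assms(1), of R] by metis
  show ?thesis
    using assms(2,3) L by (intro exI[of _ L] conjI L(1)) (auto elim: eventually_elim2)
qed

locale imex_euler_step =
  fixes s :: nat and lam :: real and M :: imex_glm
    and f g :: "'a::euclidean_space \<Rightarrow> 'a" and y :: "real \<Rightarrow> 'a" and t0 :: real
    and yin Y yout :: "real \<Rightarrow> nat \<Rightarrow> 'a"
  assumes s_pos: "s \<ge> 1"
    and euler: "glm_A M = 0\<^sub>m s s" "glm_Ahat M = lam \<cdot>\<^sub>m 1\<^sub>m s" "glm_U M = 1\<^sub>m s" "glm_V M = 1\<^sub>m s"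
    and weights_0: "\<And>i. i < s \<Longrightarrow> glm_W M $$ (i, 0) = glm_What M $$ (i, 0)"
    and smooth: "C_class s f" "C_class s g"
    and step: "local_step s s s M f g y t0 yin Y yout"
    and conditions:
      "coeff_conditions s 0 (glm_c M) (\<lambda>i k. glm_W M $$ (i, k)) (\<lambda>i j. glm_B M $$ (i, j))"
      "coeff_conditions s lam (glm_c M) (\<lambda>i k. glm_What M $$ (i, k)) (\<lambda>i j. glm_Bhat M $$ (i, j))"
begin

abbreviation "c i \<equiv> glm_c M $ i"
abbreviation "X k \<equiv> ext_deriv y (\<lambda>\<tau>. f (y \<tau>)) k"
abbreviation "Z k \<equiv> ext_deriv (\<lambda>_. 0) (\<lambda>\<tau>. g (y \<tau>)) k"

lemma incoming: "i < s \<Longrightarrow> remainder (Suc s) (\<lambda>h. yin h i - ext_expansion s M f g y t0 h i)"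
  using step unfolding local_step_def remainder_iff_bigo by auto

lemma step_equations:
  "\<forall>\<^sub>F h in at_right 0. \<forall>i<s. Y h i = (h * lam) *\<^sub>R g (Y h i) + yin h i"
  "\<forall>\<^sub>F h in at_right 0. \<forall>i<s. yout h i = h *\<^sub>R (\<Sum>j<s. glm_B M $$ (i, j) *\<^sub>R f (Y h j)) +
                   h *\<^sub>R (\<Sum>j<s. glm_Bhat M $$ (i, j) *\<^sub>R g (Y h j)) + yin h i"
  using step unfolding local_step_def imex_glm_step_euler_iff[OF euler]
  by (auto elim: eventually_mono)

lemma C_class_1: "C_class 1 f" "C_class 1 g"
  using C_class_mono[OF s_pos] smooth by blast+

lemma f_taylor:
  "0 < k \<Longrightarrow> k \<le> Suc s \<Longrightarrow> remainder (Suc s - k) (\<lambda>h. X k (t0 + a * h) -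
     (\<Sum>m<Suc s - k. ((a * h) ^ m / fact m) *\<^sub>R X (k + m) t0))"
  and g_taylor:
  "0 < k \<Longrightarrow> k \<le> Suc s \<Longrightarrow> remainder (Suc s - k) (\<lambda>h. Z k (t0 + a * h) -
     (\<Sum>m<Suc s - k. ((a * h) ^ m / fact m) *\<^sub>R Z (k + m) t0))"
  and y_taylor:
  "remainder (Suc s) (\<lambda>h. y (t0 + a * h) -
     (\<Sum>m<Suc s. ((a * h) ^ m / fact m) *\<^sub>R (X m t0 + Z m t0)))"
proof -
  have "solves_ode_near f g y t0" using step unfolding local_step_def by blast
  then obtain S where S: "open S" "t0 \<in> S"
    "\<And>t. t \<in> S \<Longrightarrow> (y has_vector_derivative f (y t) + g (y t)) (at t)"
    "cont_diff s S (\<lambda>\<tau>. f (y \<tau>))" "cont_diff s S (\<lambda>\<tau>. g (y \<tau>))"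
    using solves_ode_near_cont_diff smooth by metis
  show "0 < k \<Longrightarrow> k \<le> Suc s \<Longrightarrow> remainder (Suc s - k) (\<lambda>h. X k (t0 + a * h) -
     (\<Sum>m<Suc s - k. ((a * h) ^ m / fact m) *\<^sub>R X (k + m) t0))"
    by (rule ext_deriv_taylor[OF S(1,2,4)])
  show "0 < k \<Longrightarrow> k \<le> Suc s \<Longrightarrow> remainder (Suc s - k) (\<lambda>h. Z k (t0 + a * h) -
     (\<Sum>m<Suc s - k. ((a * h) ^ m / fact m) *\<^sub>R Z (k + m) t0))"
    by (rule ext_deriv_taylor[OF S(1,2,5)])
  show "remainder (Suc s) (\<lambda>h. y (t0 + a * h) -
     (\<Sum>m<Suc s. ((a * h) ^ m / fact m) *\<^sub>R (X m t0 + Z m t0)))"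
    by (rule solution_taylor[OF S])
qed

text \<open>One radius is needed for both the numerical and the exact values, so that a single
  Lipschitz constant compares them. The former bound is part of \<open>local_step\<close>, the
  latter follows from the Taylor expansion.\<close>

lemma stages_bounded:
  assumes "i < s"
  shows "\<exists>R. (\<forall>\<^sub>F h in at_right 0. norm (Y h i) \<le> R) \<and> (\<forall>\<^sub>F h in at_right 0. norm (y (t0 + c i * h)) \<le> R)"
proof -
  have "(\<lambda>h. norm (Y h i)) \<in> O[at_right 0](\<lambda>h. h ^ 0)"
    using step assms unfolding local_step_def by simp
  then obtain R1 where R1: "\<forall>\<^sub>F h in at_right 0. norm (Y h i) \<le> R1"
    unfolding remainder_iff_bigo[symmetric] remainder_def by auto
  have "((\<lambda>h. y (t0 + c i * h) - (\<Sum>m<Suc s. ((c i * h) ^ m / fact m) *\<^sub>R (X m t0 + Z m t0)) +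
      (\<Sum>m<Suc s. ((c i * h) ^ m / fact m) *\<^sub>R (X m t0 + Z m t0))) \<longlongrightarrow>
      0 + (\<Sum>m<Suc s. ((c i * 0) ^ m / fact m) *\<^sub>R (X m t0 + Z m t0))) (at_right 0)"
    by (intro tendsto_add remainder_1_tendsto_0[OF y_taylor] tendsto_intros) simp_all
  hence "((\<lambda>h. y (t0 + c i * h)) \<longlongrightarrow> (\<Sum>m<Suc s. ((c i * 0) ^ m / fact m) *\<^sub>R (X m t0 + Z m t0)))
      (at_right 0)" (is "(_ \<longlongrightarrow> ?l) _")
    by simp
  from order_tendstoD(2)[OF tendsto_norm[OF this], of "norm ?l + 1"]
  have "\<forall>\<^sub>F h in at_right 0. norm (y (t0 + c i * h)) < norm ?l + 1"
    by simp
  hence "\<forall>\<^sub>F h in at_right 0. norm (y (t0 + c i * h)) \<le> max R1 (norm ?l + 1)"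
    by eventually_elim auto
  moreover have "\<forall>\<^sub>F h in at_right 0. norm (Y h i) \<le> max R1 (norm ?l + 1)"
    using R1 by eventually_elim auto
  ultimately show ?thesis by blast
qed

lemma lipschitz_along_stages:
  assumes "i < s" "C_class 1 F"
  obtains L where "L \<ge> 0"
    "\<forall>\<^sub>F h in at_right 0. norm (F (Y h i) - F (y (t0 + c i * h))) \<le> L * norm (Y h i - y (t0 + c i * h))"
proof -
  obtain R where "\<forall>\<^sub>F h in at_right 0. norm (Y h i) \<le> R"
    "\<forall>\<^sub>F h in at_right 0. norm (y (t0 + c i * h)) \<le> R"
    using stages_bounded[OF assms(1)] by blast
  from remainder_compose_lipschitz[OF assms(2) this] show thesis
    using that by blast
qed

text \<open>The weight formulas are precisely the Taylor coefficients of the bracketed expression,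
  so this is the residual left when the exact solution is put into the stage equation.\<close>

lemma incoming_exact:
  assumes "i < s"
  shows "remainder (Suc s) (\<lambda>h. yin h i - (y (t0 + c i * h) - (h * lam) *\<^sub>R g (y (t0 + c i * h))))"
proof -
  let ?Ty = "\<lambda>h. \<Sum>m<Suc s. ((c i * h) ^ m / fact m) *\<^sub>R (X m t0 + Z m t0)"
  let ?Tg = "\<lambda>h. \<Sum>m<s. ((c i * h) ^ m / fact m) *\<^sub>R Z (Suc m) t0"
  have W: "glm_W M $$ (i, k) = c i ^ k / fact k" if "k \<le> s" for k
    using conditions(1) assms that unfolding coeff_conditions_def by simp
  have What: "glm_What M $$ (i, k) = c i ^ k / fact k -
      lam * (if k = 0 then 0 else c i ^ (k - 1) / fact (k - 1))" if "k \<le> s" for k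
    using conditions(2) assms that unfolding coeff_conditions_def by blast
  have ext: "ext_expansion s M f g y t0 h i = ?Ty h - lam *\<^sub>R (h *\<^sub>R ?Tg h)" for h
  proof -
    have "?Ty h = (\<Sum>k\<le>s. h ^ k *\<^sub>R ((c i ^ k / fact k) *\<^sub>R X k t0)) +
        (\<Sum>k\<le>s. h ^ k *\<^sub>R ((c i ^ k / fact k) *\<^sub>R Z k t0))"
      unfolding lessThan_Suc_atMost sum.distrib[symmetric]
      by (intro sum.cong refl) (simp add: power_mult_distrib scaleR_add_right mult_ac)
    thus ?thesis
      unfolding ext_expansion_eq scaleR_sum_right[of lam]
        taylor_polynomial_stage[where X = "\<lambda>k. Z k t0"]
      by (simp add: W What sum_subtractf scaleR_diff_left scaleR_diff_right mult_ac)
  qed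
  have "remainder s (\<lambda>h. Z 1 (t0 + c i * h) - ?Tg h)"
    using g_taylor[of 1 "c i"] by simp
  hence G: "remainder s (\<lambda>h. g (y (t0 + c i * h)) - ?Tg h)"
    by (simp add: ext_deriv_def)
  \<comment> \<open>The values of \<open>g\<close> are known only to order \<open>s\<close>; the
    factor \<open>h\<close> in front restores the missing power.\<close>
  have "remainder (Suc s) (\<lambda>h. (yin h i - ext_expansion s M f g y t0 h i) - (y (t0 + c i * h) - ?Ty h) +
      lam *\<^sub>R (h *\<^sub>R (g (y (t0 + c i * h)) - ?Tg h)))"
    by (intro remainder_add remainder_diff remainder_scaleR remainder_Suc G incoming y_taylor assms)
  thus ?thesis
    unfolding ext by (simp add: algebra_simps scaleR_diff_right)
qed

text \<open>Subtracting the two stage equations gives e = h lam (g(Y) - g(y)) + r with the residual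
  r from \<open>incoming_exact\<close>. The Lipschitz bound makes the first term a small multiple of
  e.\<close>

lemma stage_accuracy:
  assumes "i < s"
  shows "remainder (Suc s) (\<lambda>h. Y h i - y (t0 + c i * h))"
proof -
  let ?e = "\<lambda>h. Y h i - y (t0 + c i * h)"
  obtain L where L: "L \<ge> 0"
    "\<forall>\<^sub>F h in at_right 0. norm (g (Y h i) - g (y (t0 + c i * h))) \<le> L * norm (?e h)"
    by (rule lipschitz_along_stages[OF assms C_class_1(2)])
  have "((\<lambda>h. h * lam * L) \<longlongrightarrow> 0 * lam * L) (at_right 0)"
    by (intro tendsto_intros)
  \<comment> \<open>With this factor below 1/2 half of the error is absorbed on the left, whence the
    constant 2 in the domination below.\<close>
  hence small: "\<forall>\<^sub>F h in at_right 0. \<bar>h * lam * L\<bar> < 1 / 2"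
    using tendstoD[of _ 0 _ "1/2"] by (fastforce simp: dist_real_def)
  show ?thesis
  proof (rule remainder_dominated[OF incoming_exact[OF assms], of _ 2])
    show "\<forall>\<^sub>F h in at_right 0. norm (?e h) \<le>
        2 * norm (yin h i - (y (t0 + c i * h) - (h * lam) *\<^sub>R g (y (t0 + c i * h))))"
      using L(2) small step_equations(1)
    proof eventually_elim
      case (elim h)
      let ?r = "yin h i - (y (t0 + c i * h) - (h * lam) *\<^sub>R g (y (t0 + c i * h)))"
      let ?d = "g (Y h i) - g (y (t0 + c i * h))"
      have "Y h i = (h * lam) *\<^sub>R g (Y h i) + yin h i"
        using elim(3) assms by blast
      hence "?e h = (h * lam) *\<^sub>R ?d + ?r"
        by (simp add: algebra_simps scaleR_diff_right)
      hence "norm (?e h) \<le> \<bar>h * lam\<bar> * norm ?d + norm ?r"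
        by (metis norm_triangle_ineq norm_scaleR)
      also have "\<bar>h * lam\<bar> * norm ?d \<le> \<bar>h * lam\<bar> * (L * norm (?e h))"
        using elim(1) by (intro mult_left_mono) auto
      also have "\<dots> = \<bar>h * lam * L\<bar> * norm (?e h)"
        using L(1) by (simp add: abs_mult)
      also have "\<dots> \<le> 1 / 2 * norm (?e h)"
        using elim(2) by (intro mult_right_mono) auto
      finally show ?case by simp
    qed
  qed simp
qed

text \<open>One power of the stage accuracy is given away: the target \<open>p\<close> is a Taylor
  polynomial accurate to order \<open>s\<close> only, and the output multiplies it by
  \<open>h\<close>.\<close>

lemma function_accuracy:
  assumes "i < s" "C_class 1 F"
    and "remainder s (\<lambda>h. F (y (t0 + c i * h)) - p h)"
  shows "remainder s (\<lambda>h. F (Y h i) - p h)"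
proof -
  obtain L where L: "L \<ge> 0"
    "\<forall>\<^sub>F h in at_right 0. norm (F (Y h i) - F (y (t0 + c i * h))) \<le> L * norm (Y h i - y (t0 + c i * h))"
    by (rule lipschitz_along_stages[OF assms(1,2)])
  have "remainder (Suc s) (\<lambda>h. F (Y h i) - F (y (t0 + c i * h)))"
    by (rule remainder_dominated[OF stage_accuracy[OF assms(1)] L(2,1)])
  hence "remainder s (\<lambda>h. F (Y h i) - F (y (t0 + c i * h)))"
    by (rule remainder_mono) simp
  from remainder_add[OF this assms(3)] show ?thesis by simp
qed

lemma output_accuracy:
  assumes "i < s"
  shows "remainder (Suc s) (\<lambda>h. yout h i - ext_expansion s M f g y (t0 + h) h i)"
proof -
  let ?w = "\<lambda>k. glm_W M $$ (i, k)" and ?v = "\<lambda>k. glm_What M $$ (i, k)"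
  let ?b = "\<lambda>j. glm_B M $$ (i, j)" and ?d = "\<lambda>j. glm_Bhat M $$ (i, j)"
  let ?TX = "\<lambda>j h. \<Sum>m<s. ((c j * h) ^ m / fact m) *\<^sub>R X (Suc m) t0"
  let ?TZ = "\<lambda>j h. \<Sum>m<s. ((c j * h) ^ m / fact m) *\<^sub>R Z (Suc m) t0"
  let ?PX = "\<lambda>k h. \<Sum>m<Suc s - k. (h ^ m / fact m) *\<^sub>R X (k + m) t0"
  let ?PZ = "\<lambda>k h. \<Sum>m<Suc s - k. (h ^ m / fact m) *\<^sub>R Z (k + m) t0"
  have stage_f: "remainder s (\<lambda>h. f (Y h j) - ?TX j h)" if "j < s" for j
    by (rule function_accuracy[OF that C_class_1(1)])
       (use f_taylor[of 1 "c j"] in \<open>simp add: ext_deriv_def\<close>)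
  have stage_g: "remainder s (\<lambda>h. g (Y h j) - ?TZ j h)" if "j < s" for j
    by (rule function_accuracy[OF that C_class_1(2)])
       (use g_taylor[of 1 "c j"] in \<open>simp add: ext_deriv_def\<close>)
  have weights: "remainder (Suc s - k) (\<lambda>h. (?w k *\<^sub>R X k (t0 + h) + ?v k *\<^sub>R Z k (t0 + h)) -
      (?w k *\<^sub>R ?PX k h + ?v k *\<^sub>R ?PZ k h))" if "k \<le> s" for k
  proof (cases "k = 0")
    case True
    \<comment> \<open>Equality of the two weights of index 0 merges both families into a multiple of
      \<open>y\<close>, which has the full expansion.\<close>
    have "remainder (Suc s) (\<lambda>h. ?w 0 *\<^sub>R (y (t0 + 1 * h) -
        (\<Sum>m<Suc s. ((1 * h) ^ m / fact m) *\<^sub>R (X m t0 + Z m t0))))"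
      by (intro remainder_scaleR y_taylor)
    thus ?thesis
      using True weights_0[OF assms]
      by (simp add: ext_deriv_def scaleR_diff_right scaleR_add_right sum.distrib del: sum.lessThan_Suc)
  next
    case False
    hence "remainder (Suc s - k) (\<lambda>h. ?w k *\<^sub>R (X k (t0 + 1 * h) - (\<Sum>m<Suc s - k. ((1 * h) ^ m / fact m) *\<^sub>R X (k + m) t0)) +
       ?v k *\<^sub>R (Z k (t0 + 1 * h) - (\<Sum>m<Suc s - k. ((1 * h) ^ m / fact m) *\<^sub>R Z (k + m) t0)))"
      using that by (intro remainder_add remainder_scaleR f_taylor g_taylor) auto
    thus ?thesis by (simp add: scaleR_diff_right add_diff_add)
  qed
  have weighted: "remainder (Suc s) (\<lambda>h. h ^ k *\<^sub>R ((?w k *\<^sub>R X k (t0 + h) + ?v k *\<^sub>R Z k (t0 + h)) -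
      (?w k *\<^sub>R ?PX k h + ?v k *\<^sub>R ?PZ k h)))" if "k \<le> s" for k
    using remainder_power_scaleR[OF weights[OF that], of k] that by simp
  \<comment> \<open>By the output conditions every coefficient on the right of
    \<open>output_defect\<close> vanishes, for each family separately.\<close>
  have defect:
    "h *\<^sub>R (\<Sum>j<s. ?b j *\<^sub>R ?TX j h) + (\<Sum>k\<le>s. h ^ k *\<^sub>R (?w k *\<^sub>R X k t0)) -
       (\<Sum>k\<le>s. h ^ k *\<^sub>R (?w k *\<^sub>R ?PX k h)) = 0"
    "h *\<^sub>R (\<Sum>j<s. ?d j *\<^sub>R ?TZ j h) + (\<Sum>k\<le>s. h ^ k *\<^sub>R (?v k *\<^sub>R Z k t0)) -
       (\<Sum>k\<le>s. h ^ k *\<^sub>R (?v k *\<^sub>R ?PZ k h)) = 0" for h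
    unfolding output_defect[where X = "\<lambda>k. X k t0" and b = ?b and c = c and w = ?w]
      output_defect[where X = "\<lambda>k. Z k t0" and b = ?d and c = c and w = ?v]
    using conditions assms unfolding coeff_conditions_def by auto
  \<comment> \<open>All errors of replacing exact quantities by Taylor polynomials, arranged so that
    the polynomials themselves cancel by \<open>defect\<close> and the output error remains.\<close>
  have "remainder (Suc s) (\<lambda>h.
      (yin h i - ext_expansion s M f g y t0 h i)
      + h *\<^sub>R (\<Sum>j<s. ?b j *\<^sub>R (f (Y h j) - ?TX j h))
      + h *\<^sub>R (\<Sum>j<s. ?d j *\<^sub>R (g (Y h j) - ?TZ j h))
      - (\<Sum>k\<le>s. h ^ k *\<^sub>R ((?w k *\<^sub>R X k (t0 + h) + ?v k *\<^sub>R Z k (t0 + h)) -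
           (?w k *\<^sub>R ?PX k h + ?v k *\<^sub>R ?PZ k h))))"
    by (intro remainder_diff[OF remainder_add[OF remainder_add]] incoming assms remainder_Suc
          remainder_sum remainder_scaleR stage_f stage_g weighted) auto
  moreover have "\<forall>\<^sub>F h in at_right 0.
      (yin h i - ext_expansion s M f g y t0 h i)
      + h *\<^sub>R (\<Sum>j<s. ?b j *\<^sub>R (f (Y h j) - ?TX j h))
      + h *\<^sub>R (\<Sum>j<s. ?d j *\<^sub>R (g (Y h j) - ?TZ j h))
      - (\<Sum>k\<le>s. h ^ k *\<^sub>R ((?w k *\<^sub>R X k (t0 + h) + ?v k *\<^sub>R Z k (t0 + h)) -
           (?w k *\<^sub>R ?PX k h + ?v k *\<^sub>R ?PZ k h)))
      = yout h i - ext_expansion s M f g y (t0 + h) h i"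
    using step_equations(2)
  proof eventually_elim
    case (elim h)
    define sf where "sf = h *\<^sub>R (\<Sum>j<s. ?b j *\<^sub>R f (Y h j))"
    define sg where "sg = h *\<^sub>R (\<Sum>j<s. ?d j *\<^sub>R g (Y h j))"
    define tf where "tf = h *\<^sub>R (\<Sum>j<s. ?b j *\<^sub>R ?TX j h)"
    define tg where "tg = h *\<^sub>R (\<Sum>j<s. ?d j *\<^sub>R ?TZ j h)"
    define eX where "eX t = (\<Sum>k\<le>s. h ^ k *\<^sub>R (?w k *\<^sub>R X k t))" for t
    define eZ where "eZ t = (\<Sum>k\<le>s. h ^ k *\<^sub>R (?v k *\<^sub>R Z k t))" for t
    define pX where "pX = (\<Sum>k\<le>s. h ^ k *\<^sub>R (?w k *\<^sub>R ?PX k h))"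
    define pZ where "pZ = (\<Sum>k\<le>s. h ^ k *\<^sub>R (?v k *\<^sub>R ?PZ k h))"
    have 1: "h *\<^sub>R (\<Sum>j<s. ?b j *\<^sub>R (f (Y h j) - ?TX j h)) = sf - tf"
      "h *\<^sub>R (\<Sum>j<s. ?d j *\<^sub>R (g (Y h j) - ?TZ j h)) = sg - tg"
      unfolding sf_def tf_def sg_def tg_def
      by (simp_all only: scaleR_diff_right sum_subtractf)
    have 2: "(\<Sum>k\<le>s. h ^ k *\<^sub>R ((?w k *\<^sub>R X k (t0 + h) + ?v k *\<^sub>R Z k (t0 + h)) -
           (?w k *\<^sub>R ?PX k h + ?v k *\<^sub>R ?PZ k h))) = eX (t0 + h) + eZ (t0 + h) - (pX + pZ)"
      unfolding eX_def eZ_def pX_def pZ_def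
      by (simp only: scaleR_diff_right scaleR_add_right[of "_ ^ _"] sum_subtractf sum.distrib)
    have 3: "ext_expansion s M f g y t h i = eX t + eZ t" for t
      unfolding ext_expansion_eq eX_def eZ_def ..
    have 4: "yout h i = sf + sg + yin h i"
      using elim assms unfolding sf_def sg_def by blast
    have 5: "pX = tf + eX t0" "pZ = tg + eZ t0"
      using defect[of h] unfolding tf_def tg_def eX_def eZ_def pX_def pZ_def by auto
    show ?case unfolding 1 2 3 4 5 by simp
  qed
  ultimately show ?thesis by (rule remainder_cong[rotated])
qed

end

section \<open>Necessity\<close>

lemma exp_remainder:
  "remainder n (\<lambda>h. exp (c * h) - (\<Sum>m<n. (c * h) ^ m / fact m))" for c :: real
proof -
  have "remainder n (\<lambda>h. exp (0 + c * h) - (\<Sum>k<n. ((c * h) ^ k / fact k) *\<^sub>R exp (0::real)))"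
    by (rule taylor_remainder[OF open_UNIV UNIV_I, where D = "\<lambda>_. exp"])
       (auto intro!: continuous_intros DERIV_exp
             simp flip: has_real_derivative_iff_has_vector_derivative)
  thus ?thesis by simp
qed

lemma exp_vector_has_derivative:
  "((\<lambda>t. (a * exp t) *\<^sub>R b) has_vector_derivative (a * exp t) *\<^sub>R b) (at t)"
proof -
  have "(exp has_real_derivative exp t) (at t)" by (rule DERIV_exp)
  from has_vector_derivative_scaleR[OF this has_vector_derivative_const[of "a *\<^sub>R b"]]
  show ?thesis by (simp add: mult.commute)
qed

text \<open>Keeping the scalar \<open>a\<close> inside lets one fixed point of differentiation serve
  \<open>f (y t)\<close> and \<open>g (y t)\<close> of the test problem.\<close>

lemma time_deriv_exp_vector:
  "time_deriv k (\<lambda>t. (a * exp t) *\<^sub>R b) = (\<lambda>t. (a * exp t) *\<^sub>R b)"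
  by (induction k)
     (simp_all only: time_deriv_0 time_deriv_Suc vector_derivative_at[OF exp_vector_has_derivative])

text \<open>Necessity is tested on the splitting \<open>y' = (1 - th) y + th y\<close> of \<open>y' = y\<close>, with solution
  \<open>exp t *\<^sub>R b\<close>: the values \<open>th = 0\<close> and \<open>th = 1\<close> isolate the explicit and the implicit coefficients.\<close>

lemma coeff_conditions_of_order:
  fixes M :: imex_glm and th lam :: real
  assumes "glm_A M = 0\<^sub>m s s" "glm_Ahat M = lam \<cdot>\<^sub>m 1\<^sub>m s" "glm_U M = 1\<^sub>m s" "glm_V M = 1\<^sub>m s"
    and weights_0: "\<And>i. i < s \<Longrightarrow> glm_W M $$ (i, 0) = glm_What M $$ (i, 0)"
    and order: "has_order TYPE('a::euclidean_space) s s M s"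
    and stage_order: "has_stage_order TYPE('a) s s s M s"
  shows "coeff_conditions s (th * lam) (glm_c M)
    (\<lambda>i k. (1 - th) * glm_W M $$ (i, k) + th * glm_What M $$ (i, k))
    (\<lambda>i j. (1 - th) * glm_B M $$ (i, j) + th * glm_Bhat M $$ (i, j))"
proof -
  define c where "c i = glm_c M $ i" for i
  define v where "v i k = (1 - th) * glm_W M $$ (i, k) + th * glm_What M $$ (i, k)" for i k
  define \<beta> where "\<beta> i j = (1 - th) * glm_B M $$ (i, j) + th * glm_Bhat M $$ (i, j)" for i j
  define e where "e = (SOME b::'a. b \<in> Basis)"
  have e: "norm e = 1" unfolding e_def by (simp add: SOME_Basis)
  \<comment> \<open>Incoming stages are taken without any perturbation: at time 0 the expansion
    equals \<open>P i h\<close> times the unit vector \<open>e\<close>.\<close>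
  define P where "P i h = (\<Sum>k\<le>s. h ^ k * v i k)" for i and h :: real
  \<comment> \<open>Solution of the scalar stage equation Q = h lam th Q + P; the denominator is
    nonzero for small \<open>h\<close>.\<close>
  define Q where "Q i h = P i h / (1 - h * lam * th)" for i h
  define f where "f = (\<lambda>x::'a. (1 - th) *\<^sub>R x)"
  define g where "g = (\<lambda>x::'a. th *\<^sub>R x)"
  define y where "y t = exp t *\<^sub>R e" for t :: real
  define yin where "yin h i = P i h *\<^sub>R e" for h i
  define Y where "Y h i = Q i h *\<^sub>R e" for h i
  define yout where "yout h i = (h * (\<Sum>j<s. \<beta> i j * Q j h) + P i h) *\<^sub>R e" for h i

  have ext: "ext_expansion s M f g y t h i = (exp t * P i h) *\<^sub>R e" if "i < s" for t h i
  proof -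
    have X: "ext_deriv y (\<lambda>\<tau>. f (y \<tau>)) k t = (if k = 0 then exp t *\<^sub>R e else (1 - th) *\<^sub>R exp t *\<^sub>R e)" for k
      unfolding ext_deriv_def f_def y_def by (simp add: time_deriv_exp_vector split: nat.split)
    have Z: "ext_deriv (\<lambda>_. 0) (\<lambda>\<tau>. g (y \<tau>)) k t = (if k = 0 then 0 else th *\<^sub>R exp t *\<^sub>R e)" for k
      unfolding ext_deriv_def g_def y_def by (simp add: time_deriv_exp_vector split: nat.split)
    have "h ^ k *\<^sub>R (glm_W M $$ (i, k) *\<^sub>R ext_deriv y (\<lambda>\<tau>. f (y \<tau>)) k t) +
        h ^ k *\<^sub>R (glm_What M $$ (i, k) *\<^sub>R ext_deriv (\<lambda>_. 0) (\<lambda>\<tau>. g (y \<tau>)) k t) =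
        (exp t * (h ^ k * v i k)) *\<^sub>R e" for k
    proof (cases "k = 0")
      case True
      \<comment> \<open>At index 0 the mixture of the two equal weights is independent of
        \<open>th\<close>, matching slot 0, to which the implicit family contributes
        nothing.\<close>
      have "v i 0 = glm_W M $$ (i, 0)"
        unfolding v_def using weights_0[OF that] by (simp add: left_diff_distrib)
      thus ?thesis unfolding X Z True by (simp add: mult.commute)
    next
      case False
      have "exp t * (h ^ k * v i k) = h ^ k * (glm_W M $$ (i, k) * ((1 - th) * exp t)) +
          h ^ k * (glm_What M $$ (i, k) * (th * exp t))"
        unfolding v_def by (simp add: algebra_simps)
      thus ?thesis
        unfolding X Z using False by (simp only: if_False scaleR_scaleR scaleR_add_left mult.assoc)
    qed
    thus ?thesis
      unfolding ext_expansion_eq P_def sum.distrib[symmetric]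
      by (simp add: scaleR_sum_left sum_distrib_left)
  qed

  have lim: "((\<lambda>h. 1 - h * lam * th) \<longlongrightarrow> 1 - 0 * lam * th) (at_right 0)"
    by (intro tendsto_intros)
  hence denom: "\<forall>\<^sub>F h in at_right 0. 1 - h * lam * th \<noteq> 0"
    by (intro tendsto_imp_eventually_ne[where c = 1]) auto

  have step: "local_step s s s M f g y 0 yin Y yout"
    unfolding local_step_def
  proof (intro conjI allI impI)
    have "f x + g x = x" for x
      unfolding f_def g_def by (simp add: scaleR_diff_left)
    hence "(y has_vector_derivative f (y t) + g (y t)) (at t)" for t
      using exp_vector_has_derivative[of 1 e t] unfolding y_def by simp
    thus "solves_ode_near f g y 0"
      unfolding solves_ode_near_def by (intro exI[of _ "-1"] exI[of _ 1]) auto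
  next
    fix i assume "i < s"
    thus "(\<lambda>h. norm (yin h i - ext_expansion s M f g y 0 h i)) \<in> O[at_right 0](\<lambda>h. h ^ (s + 1))"
      by (simp add: ext yin_def)
  next
    show "\<forall>\<^sub>F h in at_right 0. imex_glm_step s s M f g h (yin h) (Y h) (yout h)"
      using denom
    proof eventually_elim
      case (elim h)
      have Q: "h * lam * th * Q i h + P i h = Q i h" for i
        using elim unfolding Q_def by (simp add: field_simps)
      have stage: "Y h i = (h * lam) *\<^sub>R g (Y h i) + yin h i" for i
      proof -
        have "(h * lam) *\<^sub>R g (Y h i) + yin h i = (h * lam * th * Q i h + P i h) *\<^sub>R e"
          unfolding Y_def g_def yin_def by (simp add: scaleR_add_left mult_ac)
        thus ?thesis unfolding Q Y_def by (rule sym)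
      qed
      have out: "yout h i = h *\<^sub>R (\<Sum>j<s. glm_B M $$ (i, j) *\<^sub>R f (Y h j)) +
          h *\<^sub>R (\<Sum>j<s. glm_Bhat M $$ (i, j) *\<^sub>R g (Y h j)) + yin h i" for i
      proof -
        have "(\<Sum>j<s. \<beta> i j * Q j h) = (\<Sum>j<s. glm_B M $$ (i, j) * ((1 - th) * Q j h)) +
            (\<Sum>j<s. glm_Bhat M $$ (i, j) * (th * Q j h))"
          unfolding \<beta>_def sum.distrib[symmetric] by (intro sum.cong refl) (simp add: algebra_simps)
        thus ?thesis
          unfolding yout_def Y_def f_def g_def yin_def
          by (simp only: scaleR_scaleR scaleR_sum_left[symmetric] scaleR_add_left distrib_left)
      qed
      show ?case
        unfolding imex_glm_step_euler_iff[OF assms(1-4)] using stage out by blast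
    qed
  next
    fix i
    have "((\<lambda>h. Q i h) \<longlongrightarrow> P i 0 / (1 - 0 * lam * th)) (at_right 0)"
      unfolding Q_def P_def by (intro tendsto_intros) auto
    hence "((\<lambda>h. norm (Y h i)) \<longlongrightarrow> norm ((P i 0 / (1 - 0 * lam * th)) *\<^sub>R e)) (at_right 0)"
      unfolding Y_def by (intro tendsto_intros)
    thus "(\<lambda>h. norm (Y h i)) \<in> O[at_right 0](\<lambda>h. 1)"
      by (intro bigoI_tendsto[where c = "norm ((P i 0 / (1 - 0 * lam * th)) *\<^sub>R e)"]) auto
  qed
  have smooth: "C_class N f" "C_class N g" for N
    unfolding f_def g_def by (rule C_class_scaleR)+

  have stage: "remainder (Suc s) (\<lambda>h. Q i h - exp (c i * h))" if "i < s" for i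
  proof -
    have "(\<lambda>h. norm (Y h i - y (0 + glm_c M $ i * h))) \<in> O[at_right 0](\<lambda>h. h ^ (s + 1))"
      using stage_order smooth step that unfolding has_stage_order_def by blast
    moreover have "norm (Y h i - y (0 + glm_c M $ i * h)) = norm (Q i h - exp (c i * h))" for h
      unfolding Y_def y_def c_def by (simp add: e flip: scaleR_diff_left)
    ultimately show ?thesis unfolding remainder_iff_bigo by simp
  qed
  have out: "remainder (Suc s) (\<lambda>h. h * (\<Sum>j<s. \<beta> i j * Q j h) + P i h - exp h * P i h)"
    if "i < s" for i
  proof -
    have "(\<lambda>h. norm (yout h i - ext_expansion s M f g y (0 + h) h i)) \<in> O[at_right 0](\<lambda>h. h ^ (s + 1))"
      using order smooth step that unfolding has_order_def by blast
    moreover have "norm (yout h i - ext_expansion s M f g y (0 + h) h i) =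
        norm (h * (\<Sum>j<s. \<beta> i j * Q j h) + P i h - exp h * P i h)" for h
      unfolding ext[OF that] yout_def by (simp add: e flip: scaleR_diff_left)
    ultimately show ?thesis unfolding remainder_iff_bigo by simp
  qed

  have "v i k = c i ^ k / fact k - th * lam * (if k = 0 then 0 else c i ^ (k - 1) / fact (k - 1))"
    if i: "i < s" and k: "k \<le> s" for i k
  proof -
    let ?T = "\<lambda>n h. \<Sum>m<n. (c i * h) ^ m / fact m"
    let ?q = "\<lambda>k. if k = 0 then 0 else c i ^ (k - 1) / fact (k - 1)"
    let ?a = "\<lambda>k. v i k - (c i ^ k / fact k - th * lam * ?q k)"
    \<comment> \<open>Clearing the denominator costs only a bounded factor; 2 is any number above
      the limit 1.\<close>
    have "\<forall>\<^sub>F h in at_right 0. \<bar>1 - h * lam * th\<bar> < 2"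
      using order_tendstoD(2)[OF tendsto_rabs[OF lim], of 2] by simp
    with denom have "\<forall>\<^sub>F h in at_right 0. norm (P i h - (1 - h * lam * th) * exp (c i * h)) \<le>
        2 * norm (Q i h - exp (c i * h))"
    proof eventually_elim
      case (elim h)
      have "P i h = (1 - h * lam * th) * Q i h"
        using elim(1) unfolding Q_def by simp
      hence "P i h - (1 - h * lam * th) * exp (c i * h) = (1 - h * lam * th) * (Q i h - exp (c i * h))"
        by (simp only: right_diff_distrib)
      thus ?case using elim(2) by (simp add: abs_mult mult_right_mono)
    qed
    hence "remainder (Suc s) (\<lambda>h. P i h - (1 - h * lam * th) * exp (c i * h))"
      by (rule remainder_dominated[OF stage[OF i]]) simp
    \<comment> \<open>Exchanging the exponentials for Taylor polynomials leaves a polynomial of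
      degree \<open>s\<close>; the second one may be a term shorter because of its factor
      \<open>h\<close>.\<close>
    hence "remainder (Suc s) (\<lambda>h. (P i h - (1 - h * lam * th) * exp (c i * h)) +
        (exp (c i * h) - ?T (Suc s) h) - (lam * th) *\<^sub>R (h *\<^sub>R (exp (c i * h) - ?T s h)))"
      by (intro remainder_diff[OF remainder_add] remainder_scaleR remainder_Suc exp_remainder)
    moreover have "(P i h - (1 - h * lam * th) * exp (c i * h)) +
        (exp (c i * h) - ?T (Suc s) h) - (lam * th) *\<^sub>R (h *\<^sub>R (exp (c i * h) - ?T s h)) =
        (\<Sum>k<Suc s. ?a k * h ^ k)" for h
    proof -
      have 1: "h * ?T s h = (\<Sum>k\<le>s. h ^ k * ?q k)"
        using taylor_polynomial_stage[where h = h and c = "c i" and s = s and X = "\<lambda>_. 1::real"] by simp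
      have 2: "?T (Suc s) h = (\<Sum>k\<le>s. h ^ k * (c i ^ k / fact k))"
        unfolding lessThan_Suc_atMost by (simp add: power_mult_distrib mult_ac)
      have "(P i h - (1 - h * lam * th) * exp (c i * h)) +
        (exp (c i * h) - ?T (Suc s) h) - (lam * th) *\<^sub>R (h *\<^sub>R (exp (c i * h) - ?T s h)) =
        P i h - ?T (Suc s) h + lam * th * (h * ?T s h)"
        by (simp add: algebra_simps del: sum.lessThan_Suc)
      also have "\<dots> = (\<Sum>k<Suc s. ?a k * h ^ k)"
        unfolding 1 2 unfolding P_def lessThan_Suc_atMost sum_distrib_left
          sum_subtractf[symmetric] sum.distrib[symmetric]
        by (intro sum.cong refl) (simp add: algebra_simps)
      finally show ?thesis .
    qed
    ultimately have "remainder (Suc s) (\<lambda>h. \<Sum>k<Suc s. ?a k * h ^ k)"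
      by (simp only:)
    hence "?a k = 0"
      by (rule remainder_polynomial_imp_0) (use k in simp)
    thus ?thesis by simp
  qed

  moreover have "(\<Sum>k\<le>n. v i k / fact (Suc n - k)) = (\<Sum>j<s. \<beta> i j * c j ^ n / fact n)"
    if i: "i < s" and n: "n < s" for i n
  proof -
    let ?T = "\<lambda>n x. \<Sum>m<n. x ^ m / fact m :: real"
    \<comment> \<open>The constant coefficient is 0 since \<open>P i h\<close> cancels at order 0;
      the factor \<open>h\<close> shifts the condition of index \<open>m\<close> to the power
      \<open>Suc m\<close>.\<close>
    let ?a = "\<lambda>k. case k of 0 \<Rightarrow> 0 | Suc m \<Rightarrow>
      (\<Sum>j<s. \<beta> i j * c j ^ m / fact m) - (\<Sum>k\<le>m. v i k / fact (Suc m - k))"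
    have Q: "remainder s (\<lambda>h. Q j h - ?T s (c j * h))" if "j < s" for j
      using remainder_add[OF remainder_mono[OF stage[OF that], of s] exp_remainder[of s "c j"]]
      by simp
    have E: "remainder (Suc s) (\<lambda>h. h ^ k *\<^sub>R (v i k *\<^sub>R (exp (1 * h) - ?T (Suc s - k) (1 * h))))"
      if "k \<le> s" for k
      using remainder_power_scaleR[OF remainder_scaleR[OF exp_remainder[of "Suc s - k" 1]], of k "v i k"]
        that by simp
    \<comment> \<open>Stages become Taylor polynomials at a cost of h times O(h^s), while in exp h
      times \<open>P\<close> the exponential is cut separately for each power of
      \<open>h\<close>.\<close>
    have "remainder (Suc s) (\<lambda>h. (h * (\<Sum>j<s. \<beta> i j * Q j h) + P i h - exp h * P i h)
        - h *\<^sub>R (\<Sum>j<s. \<beta> i j *\<^sub>R (Q j h - ?T s (c j * h)))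
        + (\<Sum>k\<le>s. h ^ k *\<^sub>R (v i k *\<^sub>R (exp (1 * h) - ?T (Suc s - k) (1 * h)))))"
      by (intro remainder_add[OF remainder_diff] out i remainder_Suc remainder_sum
            remainder_scaleR Q E) auto
    moreover have "(h * (\<Sum>j<s. \<beta> i j * Q j h) + P i h - exp h * P i h)
        - h *\<^sub>R (\<Sum>j<s. \<beta> i j *\<^sub>R (Q j h - ?T s (c j * h)))
        + (\<Sum>k\<le>s. h ^ k *\<^sub>R (v i k *\<^sub>R (exp (1 * h) - ?T (Suc s - k) (1 * h)))) =
        (\<Sum>k<Suc s. ?a k * h ^ k)" for h
    proof -
      have "(h * (\<Sum>j<s. \<beta> i j * Q j h) + P i h - exp h * P i h)
        - h *\<^sub>R (\<Sum>j<s. \<beta> i j *\<^sub>R (Q j h - ?T s (c j * h)))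
        + (\<Sum>k\<le>s. h ^ k *\<^sub>R (v i k *\<^sub>R (exp (1 * h) - ?T (Suc s - k) (1 * h)))) =
        h * (\<Sum>j<s. \<beta> i j * ?T s (c j * h)) + P i h
        - (\<Sum>k\<le>s. h ^ k * (v i k * ?T (Suc s - k) h))"
        unfolding P_def
        by (simp add: right_diff_distrib sum_subtractf sum_distrib_left mult_ac)
      also have "\<dots> = (\<Sum>m<s. h ^ Suc m * ?a (Suc m))"
        using output_defect[where h = h and b = "\<beta> i" and c = c and r = s and s = s and w = "v i" and X = "\<lambda>_. 1::real"]
        unfolding P_def by simp
      also have "\<dots> = (\<Sum>k<Suc s. ?a k * h ^ k)"
        unfolding sum.lessThan_Suc_shift[of _ s] by (simp add: mult.commute)
      finally show ?thesis .
    qed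
    ultimately have "remainder (Suc s) (\<lambda>h. \<Sum>k<Suc s. ?a k * h ^ k)"
      by (simp only:)
    hence "?a (Suc n) = 0"
      by (rule remainder_polynomial_imp_0) (use n in simp)
    thus ?thesis by simp
  qed
  ultimately show ?thesis
    unfolding coeff_conditions_def v_def \<beta>_def c_def by blast
qed

theorem theorem5p1:
  fixes M :: imex_glm and s :: nat and lam :: real
  assumes "s \<ge> 1"
    and "lam > 0"
    and "is_imex_glm s s s M"
    and "nonconfluent M"
    and "glm_A M = 0\<^sub>m s s"
    and "glm_Ahat M = lam \<cdot>\<^sub>m 1\<^sub>m s"
    and "glm_U M = 1\<^sub>m s"
    and "glm_V M = 1\<^sub>m s"
  shows "has_order TYPE('a::euclidean_space) s s M s \<and> has_stage_order TYPE('a) s s s M s \<longleftrightarrow>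
         glm_W M = C_mat (glm_c M) (s + 1) \<and>
         glm_What M = C_mat (glm_c M) (s + 1) - lam \<cdot>\<^sub>m (C_mat (glm_c M) (s + 1) * K_mat (s + 1)) \<and>
         glm_B M = C_mat (glm_c M) s * F_mat s * inv_mat (C_mat (glm_c M) s) \<and>
         glm_Bhat M = C_mat (glm_c M) s * F_mat s * (1\<^sub>m s - lam \<cdot>\<^sub>m K_mat s) * inv_mat (C_mat (glm_c M) s)"
proof -
  have dims: "dim_vec (glm_c M) = s" "glm_W M \<in> carrier_mat s (s + 1)"
      "glm_What M \<in> carrier_mat s (s + 1)" "glm_B M \<in> carrier_mat s s" "glm_Bhat M \<in> carrier_mat s s"
    using assms(3) unfolding is_imex_glm_def by auto
  have weights_0: "glm_W M $$ (i, 0) = glm_What M $$ (i, 0)" if "i < s" for i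
    using assms(3) that unfolding is_imex_glm_def by auto
  have inj: "inj_on (\<lambda>i. glm_c M $ i) {..<s}"
    using assms(4) dims(1) unfolding nonconfluent_def by simp
  let ?explicit = "coeff_conditions s 0 (glm_c M) (\<lambda>i k. glm_W M $$ (i, k)) (\<lambda>i j. glm_B M $$ (i, j))"
  let ?implicit = "coeff_conditions s lam (glm_c M) (\<lambda>i k. glm_What M $$ (i, k)) (\<lambda>i j. glm_Bhat M $$ (i, j))"
  have "has_order TYPE('a) s s M s \<and> has_stage_order TYPE('a) s s s M s \<longleftrightarrow> ?explicit \<and> ?implicit"
  proof
    assume "has_order TYPE('a) s s M s \<and> has_stage_order TYPE('a) s s s M s"
    note nec = coeff_conditions_of_order[OF assms(5-8) weights_0 conjunct1[OF this] conjunct2[OF this]]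
    show "?explicit \<and> ?implicit"
      using nec[of 0] nec[of 1] by simp
  next
    assume cond: "?explicit \<and> ?implicit"
    have euler: "imex_euler_step s lam M f g y t0 yin Y yout"
      if "C_class s f" "C_class s g" "local_step s s s M f g y t0 yin Y yout"
      for f g :: "'a \<Rightarrow> 'a" and y t0 yin Y yout
      using assms(1,5-8) weights_0 cond that by unfold_locales auto
    \<comment> \<open>Class C^s is enough smoothness: it makes \<open>f\<close> and \<open>g\<close>
      along the solution C^s and the solution itself C^(s+1).\<close>
    have "has_order TYPE('a) s s M s"
      unfolding has_order_def
      using imex_euler_step.output_accuracy[OF euler]
      by (auto simp: remainder_iff_bigo intro!: exI[of _ s])
    moreover have "has_stage_order TYPE('a) s s s M s"
      unfolding has_stage_order_def
      using imex_euler_step.stage_accuracy[OF euler]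
      by (auto simp: remainder_iff_bigo intro!: exI[of _ s])
    ultimately show "has_order TYPE('a) s s M s \<and> has_stage_order TYPE('a) s s s M s" ..
  qed
  thus ?thesis
    unfolding coeff_conditions_0_iff_mat[OF dims(1) inj dims(2,4)]
      coeff_conditions_iff_mat[OF dims(1) inj dims(3,5)]
    by blast
qed

end
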